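(* Let $u_*\in\mathbb{H}^\infty_{\Sigma 0}$, $N\in\{0,1,2,\dots\}$, and for $t\in[0,+\infty)$ let $$u_0(t):=e^{t\Delta}u_*,\qquad u_j(t):=\sum_{\ell=0}^{j-1}\int_0^tds\,e^{(t-s)\Delta}\mathscr{P}(u_\ell(s),u_{j-\ell-1}(s))\quad(j=1,\dots,N).$$ Let $\sigma\in\{+1,-1\}$ and let $\mathcal{H}^\sigma(u_* )$ be the set of all $(S,a)\in O(d,\mathbf{Z})\ltimes\mathbf{T}^d$ such that $\mathcal{E}_*(S,a)u_*=\sigma u_*$. Then, for all $(S,a)\in\mathcal{H}^\sigma(u_* )$, all $j\in\{0,1,\dots,N\}$ and all $t\in[0,+\infty)$, $$\mathcal{E}_*(S,a)\,u_j(t)=\sigma^{j+1}u_j(t);$$ equivalently, in terms of Fourier coefficients (with $u_{j,k}(t)$ the $k$-th Fourier coefficient of $u_j(t)$), $$u_{j,Sk}(t)=\sigma^{j+1}e^{-ia\cdot Sk}\,S\,u_{j,k}(t)\qquad\text{for all }k\in\mathbf{Z}^d.$$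
   Context: Let $d\ge 2$ be the space dimension and $\mathbf{T}^d:=(\mathbf{R}/2\pi\mathbf{Z})^d$. An $\mathbf{R}^d$-valued distribution $v$ on $\mathbf{T}^d$ has Fourier expansion $v=\sum_{k\in\mathbf{Z}^d}v_ke_k$, $e_k(x):=e^{ik\cdot x}$, with $v_k\in\mathbf{C}^d$, $\overline{v_k}=v_{-k}$. The Laplacian and its semigroup act by $(\Delta v)_k=-|k|^2v_k$ and $(e^{t\Delta}v)_k=e^{-t|k|^2}v_k$, $t\ge0$. For $n\in\mathbf{R}$, $\mathbb{H}^n_{\Sigma 0}$ is the Hilbert space of $\mathbf{R}^d$-valued distributions $v$ on $\mathbf{T}^d$ that are divergence free ($k\cdot v_k=0$ for all $k$), have zero mean ($v_0=0$) and satisfy $\sum_{k\ne0}|k|^{2n}|v_k|^2<+\infty$, with inner product $\langle v|w\rangle_n:=(2\pi)^d\sum_{k\neq0}|k|^{2n}\overline{v_k}\cdot w_k$ (where $a\cdot b:=\sum_r a_rb_r$) and norm $\|v\|_n:=\sqrt{\langle v|v\rangle_n}$. $\mathbb{H}^\infty_{\Sigma 0}:=\bigcap_{n\in\mathbf{R}}\mathbb{H}^n_{\Sigma 0}$ is a Fréchet space with the topology of the family of norms $(\|\cdot\|_n)_{n\in\mathbf{R}}$; it coincides with the space of $C^\infty$ divergence free, zero mean vector fields on $\mathbf{T}^d$. The bilinear map $\mathscr{P}$ is $\mathscr{P}(v,w):=-\mathfrak{L}(v\cdot\partial w)$, where $(v\cdot\partial w)_r:=\sum_{s=1}^d v_s\partial_sw_r$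 and $\mathfrak{L}$ is the Leray projection onto divergence free vector fields (on Fourier coefficients, $\mathfrak{L}$ acts as the orthogonal projection onto the orthogonal complement of $k$). $\mathscr{P}$ maps $\mathbb{H}^\infty_{\Sigma 0}\times\mathbb{H}^\infty_{\Sigma 0}$ continuously into $\mathbb{H}^\infty_{\Sigma 0}$. The functions $u_0,\dots,u_N$ of the claim belong to $C^\infty([0,+\infty),\mathbb{H}^\infty_{\Sigma 0})$. $O(d,\mathbf{Z}):=\{S\in\mathrm{Mat}(d\times d,\mathbf{Z})\mid S^{T}S=\mathbf{1}_d\}$ is the group of orthogonal $d\times d$ matrices with integer entries, where $S^{T}$ is the transpose. $O(d,\mathbf{Z})\ltimes\mathbf{T}^d$ is the Cartesian product $O(d,\mathbf{Z})\times\mathbf{T}^d$ with the composition law $(S,a)(U,b):=(SU,a+Sb)$. For $(S,a)$ in it and $v\in\mathbb{H}^\infty_{\Sigma 0}$, the push-forward $\mathcal{E}_*(S,a)v\in\mathbb{H}^\infty_{\Sigma 0}$ of $v$ along the map $x\mapsto Sx+a$ is $(\mathcal{E}_*(S,a)v)(x):=S\,v(S^{T}(x-a))$, $x\in\mathbf{T}^d$; its Fourier coefficients are $(\mathcal{E}_*(S,a)v)_k=e^{-ia\cdot k}\,S\,v_{S^{T}k}$. *)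

theory Defs
  imports "HOL-Analysis.Analysis"
begin

(* Conventions.  The space dimension is CARD('d).  A distribution v on the torus
   T^d = (R / 2 pi Z)^d is given by the family of its Fourier coefficients v_k, k in Z^d;
   an honest function on the torus is a 2 pi - periodic function on R^d, and a point of the
   torus is given by any representative in R^d.  All notions below that depend on a torus
   point are invariant under translations of the representative by 2 pi Z^d. *)

type_synonym 'd coeffs = "int ^ 'd \<Rightarrow> complex ^ 'd"

definition vec_of_int :: "int ^ 'd \<Rightarrow> 'a::ring_1 ^ 'd" where
  "vec_of_int k = (\<chi> r. of_int (k $ r))"

definition bdot :: "'a::comm_ring_1 ^ 'd \<Rightarrow> 'a ^ 'd \<Rightarrow> 'a" where
  "bdot a b = (\<Sum>r\<in>UNIV. a $ r * b $ r)"

definition wave_norm :: "int ^ 'd \<Rightarrow> real" where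
  "wave_norm k = norm (vec_of_int k :: real ^ 'd)"

definition fmode :: "int ^ 'd \<Rightarrow> real ^ 'd \<Rightarrow> complex" where
  "fmode k x = exp (\<i> * of_real (bdot (vec_of_int k) x))"

definition Hspace :: "real \<Rightarrow> 'd::finite coeffs set" where
  "Hspace n = {v.
     (\<forall>k r. cnj (v k $ r) = v (- k) $ r) \<and>
     (\<forall>k. bdot (vec_of_int k) (v k) = 0) \<and>
     v 0 = 0 \<and>
     (\<lambda>k. wave_norm k powr (2 * n) * (norm (v k))\<^sup>2) summable_on (- {0})}"

definition Hnorm :: "real \<Rightarrow> 'd::finite coeffs \<Rightarrow> real" where
  "Hnorm n v = sqrt ((2 * pi) ^ CARD('d) *
     (\<Sum>\<^sub>\<infinity>k\<in>- {0}. wave_norm k powr (2 * n) * (norm (v k))\<^sup>2))"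

definition Hinf :: "'d::finite coeffs set" where
  "Hinf = (\<Inter>n. Hspace n)"

definition heat :: "real \<Rightarrow> 'd::finite coeffs \<Rightarrow> 'd::finite coeffs" where
  "heat t v = (\<lambda>k. exp (- t * (wave_norm k)\<^sup>2) *\<^sub>R v k)"

(* The passage from Fourier coefficients to functions and back.  For v in Hinf the values of
   synth v are real vectors; they are kept in C^d so that no cast is needed. *)

definition synth :: "'d::finite coeffs \<Rightarrow> real ^ 'd \<Rightarrow> complex ^ 'd" where
  "synth v x = (\<Sum>\<^sub>\<infinity>k. fmode k x *s v k)"

definition fourier :: "(real ^ 'd \<Rightarrow> complex ^ 'd) \<Rightarrow> 'd::finite coeffs" where
  "fourier f k = (1 / (2 * pi) ^ CARD('d)) *\<^sub>R
     integral (cbox 0 (\<chi> r. 2 * pi)) (\<lambda>x. cnj (fmode k x) *s f x)"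

definition partial_deriv :: "'d \<Rightarrow> (real ^ 'd \<Rightarrow> complex) \<Rightarrow> real ^ 'd \<Rightarrow> complex" where
  "partial_deriv s g x = vector_derivative (\<lambda>h. g (x + h *\<^sub>R axis s 1)) (at 0)"

definition advect ::
  "(real ^ 'd \<Rightarrow> complex ^ 'd) \<Rightarrow> (real ^ 'd \<Rightarrow> complex ^ 'd) \<Rightarrow> real ^ 'd \<Rightarrow> complex ^ 'd" where
  "advect v w x = (\<chi> r. \<Sum>s\<in>UNIV. v x $ s * partial_deriv s (\<lambda>y. w y $ r) x)"

(* For k = 0 the subtracted term vanishes: the orthogonal complement of 0 is all of C^d. *)

definition leray :: "'d::finite coeffs \<Rightarrow> 'd::finite coeffs" where
  "leray v = (\<lambda>k. v k -
     (bdot (vec_of_int k) (v k) / of_real ((wave_norm k)\<^sup>2)) *s vec_of_int k)"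

definition PP :: "'d::finite coeffs \<Rightarrow> 'd::finite coeffs \<Rightarrow> 'd::finite coeffs" where
  "PP v w = (\<lambda>k. - leray (fourier (advect (synth v) (synth w))) k)"

(* Integrals of Hinf-valued functions over [a,b], in the Frechet topology of Hinf: the library's
   notion of integral (convergence of the sums over tagged divisions along division_filter),
   with the convergence taken in every norm Hnorm n. *)

definition has_Hinf_integral ::
  "(real \<Rightarrow> 'd::finite coeffs) \<Rightarrow> 'd::finite coeffs \<Rightarrow> real \<Rightarrow> real \<Rightarrow> bool" where
  "has_Hinf_integral f I a b \<longleftrightarrow>
     (\<forall>s\<in>{a..b}. f s \<in> Hinf) \<and> I \<in> Hinf \<and>
     (\<forall>n. ((\<lambda>p. Hnorm n (\<lambda>k. (\<Sum>(s, J)\<in>p. measure lborel J *\<^sub>R f s k) - I k)) \<longlongrightarrow> 0)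
       (division_filter (cbox a b)))"

definition Hinf_integral :: "real \<Rightarrow> real \<Rightarrow> (real \<Rightarrow> 'd::finite coeffs) \<Rightarrow> 'd::finite coeffs" where
  "Hinf_integral a b f = (THE I. has_Hinf_integral f I a b)"

definition OZ :: "(int ^ 'd ^ 'd) set" where
  "OZ = {S. transpose S ** S = mat 1}"

definition pushforward :: "int ^ 'd ^ 'd \<Rightarrow> real ^ 'd \<Rightarrow> 'd::finite coeffs \<Rightarrow> 'd::finite coeffs" where
  "pushforward S a v =
     fourier (\<lambda>x. map_matrix of_int S *v synth v (transpose (map_matrix of_int S) *v (x - a)))"

definition sym_set :: "real \<Rightarrow> 'd::finite coeffs \<Rightarrow> ((int ^ 'd ^ 'd) \<times> (real ^ 'd)) set" where
  "sym_set \<sigma> v = {(S, a). S \<in> OZ \<and> pushforward S a v = (\<lambda>k. \<sigma> *\<^sub>R v k)}"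

end

theory Submission
  imports Defs
begin

text \<open>
  The map \<open>(S, a)\<close> acts linearly on fields and is a symmetry of every ingredient of the
  recursion: it commutes with the heat semigroup (because \<open>S\<close> preserves the lengths of the
  wave vectors), with the bilinear map \<open>PP\<close> (because both the advection term and the
  Leray projection are built from Euclidean-invariant operations) and with time integration
  (because it is linear and continuous).  If \<open>(S, a)\<close> sends the initial datum to \<open>\<sigma>\<close> times itself,
  each summand of \<open>u j\<close> is bilinear in some \<open>u l\<close> and \<open>u (j - l - 1)\<close>, which are multiplied by
  \<open>\<sigma> ^ (l + 1)\<close> and \<open>\<sigma> ^ (j - l)\<close>; the product of the two factors is always \<open>\<sigma> ^ (j + 1)\<close>, and the
  claim follows by strong induction on \<open>j\<close>.

  The analytic content is that all objects in the recursion really are what their formulas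
  suggest.  It is handled on the side of the Fourier coefficients.  A field lies in \<open>Hinf\<close> iff its
  coefficients decay faster than every power of the wave number and satisfy the algebraic
  constraints of a real, solenoidal, mean-free field (\<open>Hinf_iff\<close>).  For rapidly decreasing
  coefficients the Fourier series can be integrated, differentiated and multiplied termwise, so
  that synthesis followed by analysis is the identity (\<open>fourier_synth\<close>), advection becomes a
  convolution (\<open>advect_synth\<close>), and the push-forward is the expected permutation of the
  coefficients (\<open>pushforward_eq\<close>).

  The integral over \<open>Hinf\<close> is defined by a description operator, hence is meaningful only once
  existence and uniqueness are known.  Both are obtained for the class \<open>smooth_curve\<close> of
  coefficientwise continuous curves whose coefficients decay rapidly, uniformly in time.  On this
  class dominated convergence turns convergence of each single coefficient into convergence in
  every Sobolev norm, so the integral exists and is computed coefficientwise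
  (\<open>Hinf_integral_eq\<close>).  The class is stable under the heat flow, under \<open>PP\<close> and under the
  Duhamel integral (\<open>smooth_curve_duhamel\<close>); therefore it contains every \<open>u j\<close>.
\<close>

section \<open>Vector algebra\<close>

lemma norm_smult_vec: "norm (c *s z) = norm c * norm z" for c :: complex and z :: "complex ^ 'd"
  by (simp add: norm_vec_def L2_set_def norm_mult power_mult_distrib sum_distrib_left[symmetric]
      real_sqrt_mult)

lemma bounded_bilinear_smult: "bounded_bilinear (\<lambda>(c::complex) (z::complex ^ 'd). c *s z)"
  by (rule bounded_bilinear.intro)
     (auto simp: vec_eq_iff algebra_simps norm_smult_vec intro!: exI[of _ 1])

lemma bounded_linear_smult_left: "bounded_linear (\<lambda>c. c *s (z::complex ^ 'd))"
  by (rule bounded_bilinear.bounded_linear_left[OF bounded_bilinear_smult])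

lemma bounded_linear_smult_right: "bounded_linear (\<lambda>z. (c::complex) *s (z::complex ^ 'd))"
  by (rule bounded_bilinear.bounded_linear_right[OF bounded_bilinear_smult])

lemma scaleR_eq_smult: "a *\<^sub>R z = of_real a *s z" for z :: "complex ^ 'd"
  unfolding vec_eq_iff vector_scaleR_component by (simp add: scaleR_conv_of_real)

lemma norm_bdot_le: "norm (bdot a b) \<le> real CARD('d) * (norm a * norm b)"
  for a b :: "complex ^ 'd"
proof -
  have "norm (bdot a b) \<le> (\<Sum>r\<in>UNIV. norm (a $ r) * norm (b $ r))"
    unfolding bdot_def by (rule order.trans[OF norm_sum]) (simp add: norm_mult)
  also have "\<dots> \<le> (\<Sum>r\<in>(UNIV::'d set). norm a * norm b)"
    by (intro sum_mono mult_mono Finite_Cartesian_Product.norm_nth_le) auto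
  finally show ?thesis by simp
qed

lemma bounded_bilinear_bdot: "bounded_bilinear (bdot :: complex ^ 'd::finite \<Rightarrow> complex ^ 'd \<Rightarrow> complex)"
proof (rule bounded_bilinear.intro)
  show "\<exists>K. \<forall>a b. norm (bdot a b) \<le> norm a * norm (b::complex ^ 'd) * K"
    using norm_bdot_le by (intro exI[of _ "real CARD('d)"] allI) (simp add: mult_ac)
qed (auto simp: bdot_def algebra_simps sum.distrib scaleR_sum_right)

lemma bdot_zero_left [simp]: "bdot 0 a = 0"
  by (simp add: bdot_def)

lemma bdot_minus_left: "bdot (- a) b = - bdot a b"
  by (simp add: bdot_def sum_negf)

lemma bdot_add_left: "bdot (a + b) c = bdot a c + bdot b c"
  by (simp add: bdot_def algebra_simps sum.distrib)

lemma bdot_add_right: "bdot c (a + b) = bdot c a + bdot c b"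
  by (simp add: bdot_def algebra_simps sum.distrib)

lemma bdot_diff_right: "bdot c (a - b) = bdot c a - bdot c b"
  by (simp add: bdot_def algebra_simps sum_subtractf)

lemma bdot_smult_right: "bdot a (c *s b) = c * bdot a b"
  by (simp add: bdot_def sum_distrib_left mult_ac)

lemma bdot_smult_left: "bdot (c *s a) b = c * bdot a b"
  by (simp add: bdot_def sum_distrib_left mult_ac)

lemma bdot_scaleR_right: "bdot a (c *\<^sub>R b) = c *\<^sub>R bdot a b" for a :: "complex ^ 'd"
  by (simp add: bdot_def scaleR_sum_right)

lemma bdot_axis: "bdot a (axis r c) = a $ r * c"
  by (simp add: bdot_def axis_def if_distrib[of "\<lambda>z. _ * z"] cong: if_cong)

lemma bdot_commute: "bdot a b = bdot b a"
  by (simp add: bdot_def mult_ac)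

lemma bdot_matrix: "bdot a (A *v b) = bdot (transpose A *v a) b"
proof -
  have "bdot a (A *v b) = (\<Sum>r\<in>UNIV. \<Sum>s\<in>UNIV. a $ r * (A $ r $ s * b $ s))"
    by (simp add: bdot_def matrix_vector_mult_def sum_distrib_left)
  also have "\<dots> = (\<Sum>s\<in>UNIV. \<Sum>r\<in>UNIV. a $ r * (A $ r $ s * b $ s))"
    by (rule sum.swap)
  finally show ?thesis
    by (simp add: bdot_def matrix_vector_mult_def transpose_def sum_distrib_left sum_distrib_right
        mult_ac)
qed

lemma bdot_vec_of_int_self: "bdot (vec_of_int k) (vec_of_int k) = complex_of_real ((wave_norm k)\<^sup>2)"
  by (simp add: bdot_def wave_norm_def norm_vec_def L2_set_def vec_of_int_def sum_nonneg
      power2_eq_square)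

lemma vec_of_int_simps [simp]:
  "vec_of_int (0::int ^ 'd) = (0::'a::ring_1 ^ 'd)"
  "vec_of_int (h + k) = vec_of_int h + vec_of_int k"
  "vec_of_int (h - k) = vec_of_int h - vec_of_int k"
  "vec_of_int (- k) = - vec_of_int k"
  by (simp_all add: vec_of_int_def vec_eq_iff)

lemma vec_of_int_mult: "vec_of_int (A *v k) = map_matrix of_int A *v vec_of_int k"
  by (simp add: vec_of_int_def vec_eq_iff matrix_vector_mult_def)

lemma norm_vec_of_int: "norm (vec_of_int k :: complex ^ 'd) = wave_norm k"
  by (simp add: wave_norm_def norm_vec_def L2_set_def vec_of_int_def)

lemma wave_norm_nonneg [simp]: "0 \<le> wave_norm k"
  by (simp add: wave_norm_def)

lemma wave_norm_minus [simp]: "wave_norm (- k) = wave_norm k"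
  by (simp add: wave_norm_def)

lemma abs_nth_le_wave_norm: "\<bar>real_of_int (k $ r)\<bar> \<le> wave_norm k" for k :: "int ^ 'd"
  using Finite_Cartesian_Product.norm_nth_le[of "vec_of_int k :: real ^ 'd" r] by (simp add: wave_norm_def vec_of_int_def)

lemma wave_norm_ge_1: "k \<noteq> 0 \<Longrightarrow> 1 \<le> wave_norm k"
proof -
  assume "k \<noteq> 0"
  then obtain r where "k $ r \<noteq> 0" by (auto simp: vec_eq_iff)
  then have "1 \<le> \<bar>real_of_int (k $ r)\<bar>" by linarith
  then show ?thesis using abs_nth_le_wave_norm[of k r] by linarith
qed

section \<open>Infinite sums\<close>

lemma infsum_linear:
  assumes "bounded_linear h" "f summable_on A"
  shows "(\<Sum>\<^sub>\<infinity>x\<in>A. h (f x)) = h (infsum f A)"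
  using has_sum_bounded_linear[OF assms(1) has_sum_infsum[OF assms(2)]]
  by (simp add: infsumI o_def)

lemma has_sum_sum:
  fixes f :: "'i \<Rightarrow> 'a \<Rightarrow> 'b::{topological_comm_monoid_add}"
  shows "(\<And>i. i \<in> I \<Longrightarrow> (f i has_sum l i) A) \<Longrightarrow> ((\<lambda>x. \<Sum>i\<in>I. f i x) has_sum (\<Sum>i\<in>I. l i)) A"
  by (induction I rule: infinite_finite_induct) (auto intro: has_sum_add)

lemma summable_on_norm_bound:
  fixes f :: "'a \<Rightarrow> 'b::banach"
  assumes "g summable_on A" "\<And>x. x \<in> A \<Longrightarrow> norm (f x) \<le> g x"
  shows "f summable_on A"
proof (rule abs_summable_summable)
  show "(\<lambda>x. norm (f x)) summable_on A"
    using assms by (rule summable_on_comparison_test) auto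
qed

text \<open>
  Tannery's theorem along an arbitrary filter.  It is applied to limits in time and to Riemann sums
  along the filter of tagged divisions, neither of which is a sequence.
\<close>
lemma tendsto_infsum_dominated:
  fixes f :: "'a \<Rightarrow> 'b \<Rightarrow> 'c::banach"
  assumes lim: "\<And>k. k \<in> X \<Longrightarrow> ((\<lambda>s. f s k) \<longlongrightarrow> l k) F"
    and dom: "\<forall>\<^sub>F s in F. \<forall>k\<in>X. norm (f s k) \<le> M k"
    and M: "M summable_on X"
  shows "((\<lambda>s. \<Sum>\<^sub>\<infinity>k\<in>X. f s k) \<longlongrightarrow> (\<Sum>\<^sub>\<infinity>k\<in>X. l k)) F"
proof (cases "F = bot")
  case F: False
  define A where "A = {s. \<forall>k\<in>X. norm (f s k) \<le> M k}"
  have A: "\<forall>\<^sub>F s in F. s \<in> A" using dom by (simp add: A_def)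
  have unif: "uniform_limit A (\<lambda>Y s. \<Sum>k\<in>Y. f s k) (\<lambda>s. \<Sum>\<^sub>\<infinity>k\<in>X. f s k) (finite_subsets_at_top X)"
    by (rule Weierstrass_m_test_general[OF _ M]) (auto simp: A_def)
  have lM: "norm (l k) \<le> M k" if "k \<in> X" for k
  proof (rule tendsto_upperbound[OF tendsto_norm[OF lim[OF that]] _ F])
    show "\<forall>\<^sub>F s in F. norm (f s k) \<le> M k"
      using dom by (rule eventually_mono) (use that in auto)
  qed
  have "l summable_on X"
  proof (rule abs_summable_summable)
    show "(\<lambda>k. norm (l k)) summable_on X"
      using M by (rule summable_on_comparison_test) (use lM in auto)
  qed
  then have liml: "((\<lambda>Y. \<Sum>k\<in>Y. l k) \<longlongrightarrow> (\<Sum>\<^sub>\<infinity>k\<in>X. l k)) (finite_subsets_at_top X)"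
    by (rule infsum_tendsto)
  show ?thesis
  proof (rule swap_uniform_limit'[OF _ liml unif A])
    show "\<forall>\<^sub>F Y in finite_subsets_at_top X. ((\<lambda>s. \<Sum>k\<in>Y. f s k) \<longlongrightarrow> (\<Sum>k\<in>Y. l k)) F"
      by (rule eventually_finite_subsets_at_top_weakI) (auto intro!: tendsto_sum lim)
  qed auto
qed simp

section \<open>Rapidly decreasing coefficients\<close>

text \<open>
  Adding 1 to the wave number makes the weight submultiplicative (\<open>weight_mult\<close>), which is what
  convolutions need, and keeps it positive at the zero mode.
\<close>
definition weight :: "int ^ 'd \<Rightarrow> real" where
  "weight k = 1 + wave_norm k"

lemma weight_ge_1 [simp]: "1 \<le> weight k"
  by (simp add: weight_def)

lemma weight_pos [simp]: "0 < weight k"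
  using weight_ge_1[of k] by linarith

lemma weight_nonneg [simp]: "0 \<le> weight k"
  by (simp add: less_imp_le)

lemma wave_norm_le_weight: "wave_norm k \<le> weight k"
  by (simp add: weight_def)

lemma weight_mult: "weight k \<le> weight (k - h) * weight h" for h k :: "int ^ 'd"
proof -
  have "wave_norm k \<le> wave_norm (k - h) + wave_norm h"
    using norm_triangle_ineq[of "vec_of_int (k - h) :: real ^ 'd" "vec_of_int h"]
    by (simp add: wave_norm_def)
  moreover have "0 \<le> wave_norm (k - h) * wave_norm h" by simp
  ultimately show ?thesis
    unfolding weight_def distrib_left distrib_right by linarith
qed

lemma summable_on_int_inverse_squares: "(\<lambda>n::int. 1 / (1 + (real_of_int n)\<^sup>2)) summable_on UNIV"
proof -
  have "summable (\<lambda>n. 1 / (1 + (real n)\<^sup>2))"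
  proof (rule summable_comparison_test')
    show "summable (\<lambda>n. inverse ((real n) ^ 2))"
      by (rule inverse_power_summable) simp
    show "norm (1 / (1 + (real n)\<^sup>2)) \<le> inverse ((real n) ^ 2)" if "n \<ge> 1" for n
      using that by (auto simp: field_simps add_pos_nonneg)
  qed
  then have s: "(\<lambda>n. 1 / (1 + (real n)\<^sup>2)) summable_on UNIV"
    by (subst summable_on_UNIV_nonneg_real_iff) auto
  have "(\<lambda>n::int. 1 / (1 + (real_of_int n)\<^sup>2)) summable_on (range int)"
    using s by (subst summable_on_reindex) (auto simp: o_def)
  moreover have "(\<lambda>n::int. 1 / (1 + (real_of_int n)\<^sup>2)) summable_on (range (\<lambda>n. - int n))"
    using s by (subst summable_on_reindex) (auto simp: o_def inj_on_def)
  ultimately have "(\<lambda>n::int. 1 / (1 + (real_of_int n)\<^sup>2)) summable_on (range int \<union> range (\<lambda>n. - int n))"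
    by (rule summable_on_union)
  moreover have "range int \<union> range (\<lambda>n. - int n) = UNIV"
    by (auto simp: image_iff) (metis int_cases2)
  ultimately show ?thesis by simp
qed

text \<open>
  The weight squared dominates \<open>1 + (k $ r)\<^sup>2\<close> for each of the \<open>CARD('d)\<close> coordinates, so this power of
  the weight dominates the product over all coordinates, and the sum is at most a power of a
  convergent one-dimensional sum.
\<close>
lemma summable_on_inverse_weight:
  "(\<lambda>k::int ^ 'd. 1 / weight k ^ (2 * CARD('d))) summable_on UNIV"
proof -
  let ?g = "\<lambda>n::int. 1 / (1 + (real_of_int n)\<^sup>2)"
  define C where "C = infsum ?g UNIV"
  have le: "1 / weight k ^ (2 * CARD('d)) \<le> (\<Prod>r\<in>UNIV. ?g (k $ r))" for k :: "int ^ 'd"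
  proof -
    have "1 + (real_of_int (k $ r))\<^sup>2 \<le> (weight k)\<^sup>2" for r
    proof -
      have "(real_of_int (k $ r))\<^sup>2 \<le> (wave_norm k)\<^sup>2"
        using abs_nth_le_wave_norm[of k r] by (metis abs_le_square_iff abs_of_nonneg wave_norm_nonneg)
      then show ?thesis
        using wave_norm_nonneg[of k] unfolding weight_def power2_sum one_power2 by linarith
    qed
    then have "(\<Prod>r\<in>(UNIV::'d set). 1 / (weight k)\<^sup>2) \<le> (\<Prod>r\<in>UNIV. ?g (k $ r))"
      by (intro prod_mono conjI frac_le) (auto intro: add_pos_nonneg)
    then show ?thesis by (simp add: power_mult power_one_over)
  qed
  have bound: "(\<Sum>k\<in>F. 1 / weight k ^ (2 * CARD('d))) \<le> C ^ CARD('d)" if "finite F" for F :: "(int ^ 'd) set"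
  proof -
    define B where "B = (\<Union>k\<in>F. range (($) k))"
    have B: "finite B" using that by (auto simp: B_def)
    have inj: "inj_on ($) F" by (rule inj_onI) (simp add: vec_eq_iff)
    have "(\<Sum>k\<in>F. 1 / weight k ^ (2 * CARD('d))) \<le> (\<Sum>k\<in>F. \<Prod>r\<in>UNIV. ?g (k $ r))"
      by (intro sum_mono le)
    also have "\<dots> = (\<Sum>g\<in>($) ` F. \<Prod>r\<in>UNIV. ?g (g r))"
      using inj by (simp add: sum.reindex)
    also have "\<dots> \<le> (\<Sum>g\<in>PiE (UNIV::'d set) (\<lambda>_. B). \<Prod>r\<in>UNIV. ?g (g r))"
    proof (rule sum_mono2)
      show "finite (PiE (UNIV::'d set) (\<lambda>_. B))" using B by (intro finite_PiE) auto
      show "($) ` F \<subseteq> PiE UNIV (\<lambda>_. B)" by (auto simp: B_def)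
    qed (auto intro!: prod_nonneg)
    also have "\<dots> = (\<Prod>r\<in>(UNIV::'d set). \<Sum>n\<in>B. ?g n)"
      using B by (subst prod_sum_PiE) auto
    also have "\<dots> \<le> (\<Prod>r\<in>(UNIV::'d set). C)"
      unfolding C_def using B summable_on_int_inverse_squares
      by (intro prod_mono conjI sum_nonneg finite_sum_le_infsum) auto
    finally show ?thesis by simp
  qed
  show ?thesis
    by (rule nonneg_bdd_above_summable_on) (auto intro!: bdd_aboveI bound)
qed

text \<open>
  Decay faster than any power, with constants uniform over the parameter set \<open>A\<close>.  A single family
  of coefficients is the case of a one-point parameter set.
\<close>
definition rapid_on :: "'s set \<Rightarrow> ('s \<Rightarrow> 'd::finite coeffs) \<Rightarrow> bool" where
  "rapid_on A f \<longleftrightarrow> (\<forall>n. \<exists>C. \<forall>s\<in>A. \<forall>k. weight k ^ n * norm (f s k) \<le> C)"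

abbreviation rapid :: "'d::finite coeffs \<Rightarrow> bool" where
  "rapid v \<equiv> rapid_on (UNIV::unit set) (\<lambda>_. v)"

lemma rapid_onD: "rapid_on A f \<Longrightarrow> s \<in> A \<Longrightarrow> rapid (f s)"
  by (force simp: rapid_on_def)

lemma rapid_on_const: "rapid v \<Longrightarrow> rapid_on A (\<lambda>_. v)"
  by (force simp: rapid_on_def)

lemma rapid_onE:
  assumes "rapid_on A f"
  obtains C where "C \<ge> 0" "\<And>s k. s \<in> A \<Longrightarrow> weight k ^ n * norm (f s k) \<le> C"
proof -
  obtain C where "\<And>s k. s \<in> A \<Longrightarrow> weight k ^ n * norm (f s k) \<le> C"
    using assms by (meson rapid_on_def)
  then show ?thesis by (intro that[of "max C 0"]) (auto simp: le_max_iff_disj)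
qed

text \<open>
  Uniform decay yields one summable majorant for all parameters at once: some additional powers of
  the weight are spent on summability.
\<close>
lemma rapid_on_dominated:
  assumes "rapid_on A (f :: 's \<Rightarrow> 'd::finite coeffs)"
  obtains M where "M summable_on UNIV" "\<And>k. 0 \<le> M k"
    "\<And>s k. s \<in> A \<Longrightarrow> weight k ^ n * norm (f s k) \<le> M k"
proof -
  obtain C where C: "C \<ge> 0" "\<And>s k. s \<in> A \<Longrightarrow> weight k ^ (n + 2 * CARD('d)) * norm (f s k) \<le> C"
    by (rule rapid_onE[OF assms, where n = "n + 2 * CARD('d)"]) (rule that)
  show ?thesis
  proof (rule that[of "\<lambda>k. C * (1 / weight k ^ (2 * CARD('d)))"])
    show "(\<lambda>k. C * (1 / weight (k::int ^ 'd) ^ (2 * CARD('d)))) summable_on UNIV"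
      by (intro summable_on_cmult_right summable_on_inverse_weight)
    show "weight k ^ n * norm (f s k) \<le> C * (1 / weight k ^ (2 * CARD('d)))" if "s \<in> A" for s k
      using C(2)[OF that, of k] by (simp add: field_simps power_add)
  qed (use C(1) in auto)
qed

lemma rapid_abs_summable:
  assumes "rapid v"
  shows "(\<lambda>k. weight k ^ n * norm (v k)) summable_on UNIV"
proof -
  obtain M where "M summable_on UNIV" "\<And>k. weight k ^ n * norm (v k) \<le> M k"
    by (rule rapid_on_dominated[OF assms, where n = n]) auto
  then show ?thesis by (rule summable_on_comparison_test) auto
qed

lemma rapid_norm_summable: "rapid v \<Longrightarrow> (\<lambda>k. norm (v k)) summable_on UNIV"
  using rapid_abs_summable[of v 0] by simp

lemma rapid_on_le:
  assumes "rapid_on A f" "\<And>s k. s \<in> A \<Longrightarrow> norm (g s k) \<le> c * norm (f s k)"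
  shows "rapid_on A g"
  unfolding rapid_on_def
proof
  fix n
  obtain C where C: "C \<ge> 0" "\<And>s k. s \<in> A \<Longrightarrow> weight k ^ n * norm (f s k) \<le> C"
    by (rule rapid_onE[OF assms(1), where n = n]) (rule that)
  have "weight k ^ n * norm (g s k) \<le> \<bar>c\<bar> * C" if "s \<in> A" for s k
  proof -
    have "norm (g s k) \<le> \<bar>c\<bar> * norm (f s k)"
      using assms(2)[OF that, of k] by (smt (verit) mult_right_mono norm_ge_zero)
    then have "weight k ^ n * norm (g s k) \<le> weight k ^ n * (\<bar>c\<bar> * norm (f s k))"
      by (intro mult_left_mono) auto
    also have "\<dots> = \<bar>c\<bar> * (weight k ^ n * norm (f s k))" by simp
    also have "\<dots> \<le> \<bar>c\<bar> * C" by (intro mult_left_mono C that) auto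
    finally show ?thesis .
  qed
  then show "\<exists>C. \<forall>s\<in>A. \<forall>k. weight k ^ n * norm (g s k) \<le> C" by blast
qed

lemma rapid_on_add:
  assumes "rapid_on A f" "rapid_on A g"
  shows "rapid_on A (\<lambda>s k. f s k + g s k)"
  unfolding rapid_on_def
proof
  fix n
  obtain C where C: "\<And>s k. s \<in> A \<Longrightarrow> weight k ^ n * norm (f s k) \<le> C"
    by (rule rapid_onE[OF assms(1), where n = n]) (rule that)
  obtain D where D: "\<And>s k. s \<in> A \<Longrightarrow> weight k ^ n * norm (g s k) \<le> D"
    by (rule rapid_onE[OF assms(2), where n = n]) (rule that)
  have "weight k ^ n * norm (f s k + g s k) \<le> C + D" if "s \<in> A" for s k
  proof -
    have "weight k ^ n * norm (f s k + g s k) \<le> weight k ^ n * (norm (f s k) + norm (g s k))"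
      by (intro mult_left_mono norm_triangle_ineq) auto
    also have "\<dots> \<le> C + D" using C[OF that, of k] D[OF that, of k] by (simp add: algebra_simps)
    finally show ?thesis .
  qed
  then show "\<exists>C. \<forall>s\<in>A. \<forall>k. weight k ^ n * norm (f s k + g s k) \<le> C" by blast
qed

lemma rapid_on_sum:
  "(\<And>i. i \<in> I \<Longrightarrow> rapid_on A (f i)) \<Longrightarrow> rapid_on A (\<lambda>s k. \<Sum>i\<in>I. f i s k)"
proof (induction I rule: infinite_finite_induct)
  case (insert i I)
  then show ?case using rapid_on_add[of A "f i" "\<lambda>s k. \<Sum>i\<in>I. f i s k"] by simp
qed (force simp: rapid_on_def)+

section \<open>Fourier series\<close>

lemma fmode_0 [simp]: "fmode 0 x = 1"
  by (simp add: fmode_def)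

lemma fmode_add_left: "fmode (h + k) x = fmode h x * fmode k x"
  by (simp add: fmode_def bdot_add_left distrib_left exp_add)

lemma fmode_add_right: "fmode k (x + y) = fmode k x * fmode k y"
  by (simp add: fmode_def bdot_add_right distrib_left exp_add)

lemma cnj_fmode: "cnj (fmode k x) = fmode (- k) x"
  by (simp add: fmode_def exp_cnj bdot_minus_left)

lemma norm_fmode [simp]: "norm (fmode k x) = 1"
  by (simp add: fmode_def)

lemma fmode_axis: "fmode k (axis r h) = exp (\<i> * of_real (of_int (k $ r) * h))"
  by (simp add: fmode_def bdot_axis vec_of_int_def)

lemma norm_fmode_smult [simp]: "norm (fmode k x *s z) = norm z"
  by (simp add: norm_smult_vec)

lemma continuous_on_fmode [continuous_intros]: "continuous_on A (fmode k)"
  unfolding fmode_def bdot_def by (intro continuous_intros)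

text \<open>
  A translation by half a wavelength in a direction in which the mode oscillates flips its sign,
  whereas by periodicity it does not change the integral over a full period box.  This replaces
  Fubini's theorem: only additivity and translation invariance of the integral enter.
\<close>
lemma integral_fmode:
  fixes k :: "int ^ 'd"
  assumes k: "k \<noteq> 0"
  shows "integral (cbox 0 (\<chi> r. 2 * pi)) (fmode k) = 0"
proof -
  obtain r where r: "k $ r \<noteq> 0"
    using k by (auto simp: vec_eq_iff)
  \<comment> \<open>\<open>J c d\<close> integrates over the slab on which coordinate \<open>r\<close> runs from \<open>c\<close> to \<open>d\<close>.\<close>
  define lo hi :: "real \<Rightarrow> real ^ 'd" where "lo c = axis r c"
    and "hi d = (\<chi> i. if i = r then d else 2 * pi)" for c d
  define J where "J c d = integral (cbox (lo c) (hi d)) (fmode k)" for c d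
  have shift: "J (c + h) (d + h) = fmode k (axis r h) * J c d" for c d h
  proof -
    have "J (c + h) (d + h) = integral (cbox (lo c + axis r h) (hi d + axis r h)) (fmode k)"
      unfolding J_def by (rule arg_cong2[where f = "\<lambda>a b. integral (cbox a b) (fmode k)"])
        (auto simp: lo_def hi_def vec_eq_iff axis_def)
    also have "\<dots> = integral (cbox (lo c) (hi d)) (fmode k \<circ> (+) (axis r h))"
      by (rule integral_shift_cbox_plus[symmetric])
    also have "\<dots> = fmode k (axis r h) * J c d"
      by (simp add: o_def fmode_add_right J_def)
    finally show ?thesis .
  qed
  have split: "J c d = J c e + J e d" if "c \<le> e" "e \<le> d" for c d e
  proof -
    have ax: "x \<bullet> axis r 1 = x $ r" for x :: "real ^ 'd"
      by (simp add: inner_axis)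
    have nth: "lo b $ i = (if i = r then b else 0)" "hi b $ i = (if i = r then b else 2 * pi)" for b i
      by (auto simp: lo_def hi_def axis_def)
    have all: "(\<forall>i. Q i) \<longleftrightarrow> Q r \<and> (\<forall>i. i \<noteq> r \<longrightarrow> Q i)" for Q
      by metis
    have mem: "x \<in> cbox (lo a) (hi b) \<longleftrightarrow>
        a \<le> x $ r \<and> x $ r \<le> b \<and> (\<forall>i. i \<noteq> r \<longrightarrow> 0 \<le> x $ i \<and> x $ i \<le> 2 * pi)" for x a b
      unfolding mem_box_cart by (subst all) (auto simp: nth)
    have 1: "cbox (lo c) (hi d) \<inter> {x. x \<bullet> axis r 1 \<le> e} = cbox (lo c) (hi e)"
      using that by (auto simp: mem ax)
    have 2: "cbox (lo c) (hi d) \<inter> {x. x \<bullet> axis r 1 \<ge> e} = cbox (lo e) (hi d)"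
      using that by (auto simp: mem ax)
    have int: "fmode k integrable_on cbox a b" for a b
      by (intro integrable_continuous continuous_intros)
    have "(fmode k has_integral (J c e + J e d)) (cbox (lo c) (hi d))"
    proof (rule has_integral_split)
      show "(fmode k has_integral J c e) (cbox (lo c) (hi d) \<inter> {x. x \<bullet> axis r 1 \<le> e})"
        unfolding 1 J_def using int by (rule integrable_integral)
      show "(fmode k has_integral J e d) (cbox (lo c) (hi d) \<inter> {x. x \<bullet> axis r 1 \<ge> e})"
        unfolding 2 J_def using int by (rule integrable_integral)
      show "(axis r 1 :: real ^ 'd) \<in> Basis" by simp
    qed
    then show ?thesis unfolding J_def by (simp add: integral_unique)
  qed
  \<comment> \<open>Half a wavelength in direction \<open>r\<close>; it fits into the period because \<open>\<bar>k $ r\<bar> \<ge> 1\<close>.\<close>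
  define h where "h = pi / \<bar>of_int (k $ r)\<bar>"
  have h: "0 \<le> h" "h \<le> 2 * pi"
  proof -
    have "1 \<le> \<bar>real_of_int (k $ r)\<bar>" using r by linarith
    then show "0 \<le> h" "h \<le> 2 * pi"
      unfolding h_def by (auto simp: divide_le_eq intro: order.trans[of _ "2 * pi * 1"])
  qed
  have half: "fmode k (axis r h) = -1"
  proof (cases "k $ r > 0")
    case True
    then have "of_int (k $ r) * h = pi" by (simp add: h_def)
    then show ?thesis by (simp add: fmode_axis del: of_real_mult)
  next
    case False
    then have "of_int (k $ r) * h = - pi" using r by (simp add: h_def)
    then have "fmode k (axis r h) = exp (- (\<i> * of_real pi))"
      unfolding fmode_axis by simp
    then show ?thesis by (simp add: exp_minus)
  qed
  have full: "fmode k (axis r (2 * pi)) = 1"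
    using exp_integer_2pi[of "of_int (k $ r)"] by (simp add: fmode_axis mult_ac)
  have "J 0 (2 * pi) = J 0 h + J h (2 * pi)"
    using h by (intro split)
  also have "J 0 h = J (2 * pi) (2 * pi + h)"
    using shift[of 0 "2 * pi" h] by (simp add: full add.commute)
  also have "J (2 * pi) (2 * pi + h) + J h (2 * pi) = J h (2 * pi + h)"
    using split[of h "2 * pi" "2 * pi + h"] h by simp
  also have "\<dots> = - J 0 (2 * pi)"
    using shift[of 0 h "2 * pi"] by (simp add: half)
  finally have "J 0 (2 * pi) = 0" by simp
  moreover have "lo 0 = 0" "hi (2 * pi) = (\<chi> r. 2 * pi)"
    by (auto simp: lo_def hi_def vec_eq_iff axis_def)
  ultimately show ?thesis by (simp add: J_def)
qed

lemma summable_synth: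
  assumes "(\<lambda>k. norm (c k)) summable_on UNIV"
  shows "(\<lambda>k. fmode k x *s c k) summable_on UNIV"
  by (rule abs_summable_summable) (use assms in \<open>simp add: norm_smult_vec\<close>)

text \<open>
  An absolutely summable Fourier series converges uniformly, so it may be integrated termwise
  against a mode, and orthogonality of the modes leaves a single coefficient.
\<close>
lemma fourier_synth:
  fixes c :: "'d::finite coeffs"
  assumes c: "(\<lambda>k. norm (c k)) summable_on UNIV"
  shows "fourier (synth c) = c"
proof
  fix k
  let ?B = "cbox 0 (\<chi> r. 2 * pi) :: (real ^ 'd) set"
  let ?G = "\<lambda>x. \<Sum>\<^sub>\<infinity>h. fmode (h - k) x *s c h"
  have "cnj (fmode k x) *s synth c x = ?G x" for x
    unfolding synth_def
    by (subst infsum_linear[OF bounded_linear_smult_right summable_synth[OF c], symmetric])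
       (simp add: cnj_fmode fmode_add_left[symmetric] vector_smult_assoc)
  then have eq: "integral ?B (\<lambda>x. cnj (fmode k x) *s synth c x) = integral ?B ?G"
    by simp
  have unif: "uniform_limit ?B (\<lambda>X x. \<Sum>h\<in>X. fmode (h - k) x *s c h) ?G (finite_subsets_at_top UNIV)"
    by (rule Weierstrass_m_test_general[OF _ c]) (simp add: norm_smult_vec)
  have cont: "continuous_on ?B (\<lambda>x. \<Sum>h\<in>X. fmode (h - k) x *s c h)" for X
    by (intro continuous_intros bounded_linear.continuous_on[OF bounded_linear_smult_left])
  obtain I J where I: "\<And>X. ((\<lambda>x. \<Sum>h\<in>X. fmode (h - k) x *s c h) has_integral I X) ?B"
    and J: "(?G has_integral J) ?B" and lim: "(I \<longlongrightarrow> J) (finite_subsets_at_top UNIV)"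
    using uniform_limit_integral_cbox[OF unif cont] by auto
  let ?V = "(2 * pi) ^ CARD('d)"
  have mode: "((\<lambda>x. fmode (h - k) x *s c h) has_integral (if h = k then ?V *\<^sub>R c k else 0)) ?B" for h
  proof -
    have "(fmode (h - k) has_integral integral ?B (fmode (h - k))) ?B"
      by (intro integrable_integral integrable_continuous continuous_intros)
    moreover have "integral ?B (fmode (h - k)) = (if h = k then of_real ?V else 0)"
    proof (cases "h = k")
      case True
      have "fmode (h - k) = (\<lambda>x. 1)" using True by auto
      moreover have "measure lborel ?B = ?V"
      proof (subst content_cbox_cart)
        have "0 \<in> ?B" by (simp add: mem_box_cart)
        then show "?B \<noteq> {}" by blast
      qed simp
      ultimately show ?thesis using True by (simp add: scaleR_conv_of_real)
    qed (simp add: integral_fmode)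
    ultimately have "(fmode (h - k) has_integral (if h = k then of_real ?V else 0)) ?B"
      by simp
    from has_integral_linear[OF this bounded_linear_smult_left[of "c h"]]
    have "((\<lambda>x. fmode (h - k) x *s c h) has_integral (if h = k then of_real ?V else 0) *s c h) ?B"
      by (simp add: o_def)
    also have "(if h = k then of_real ?V else 0) *s c h = (if h = k then ?V *\<^sub>R c k else 0)"
      by (simp add: scaleR_eq_smult)
    finally show ?thesis .
  qed
  have IX: "I X = (if k \<in> X then ?V *\<^sub>R c k else 0)" if "finite X" for X
  proof -
    have "((\<lambda>x. \<Sum>h\<in>X. fmode (h - k) x *s c h) has_integral
        (\<Sum>h\<in>X. if h = k then ?V *\<^sub>R c k else 0)) ?B"
      by (intro has_integral_sum that mode)
    with I[of X] have "I X = (\<Sum>h\<in>X. if h = k then ?V *\<^sub>R c k else 0)"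
      by (rule has_integral_unique)
    with that show ?thesis by simp
  qed
  have "\<forall>\<^sub>F X in finite_subsets_at_top UNIV. I X = ?V *\<^sub>R c k"
    unfolding eventually_finite_subsets_at_top
    by (rule exI[of _ "{k}"]) (auto simp: IX)
  then have "(I \<longlongrightarrow> ?V *\<^sub>R c k) (finite_subsets_at_top UNIV)"
    by (rule tendsto_eventually)
  with lim have "J = ?V *\<^sub>R c k"
    by (intro tendsto_unique[OF _ lim]) auto
  with J have "integral ?B ?G = ?V *\<^sub>R c k"
    by (simp add: integral_unique)
  then show "fourier (synth c) k = c k"
    unfolding fourier_def eq by simp
qed

section \<open>The advection term in Fourier variables\<close>

lemma quadratic_bound_has_vector_derivative:
  fixes f :: "real \<Rightarrow> 'a::real_normed_vector"
  assumes "\<And>t. norm (f t - f 0 - t *\<^sub>R D) \<le> K * t\<^sup>2"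
  shows "(f has_vector_derivative D) (at 0)"
proof -
  have "((\<lambda>t. norm (f t - f 0 - t *\<^sub>R D) / norm t) \<longlongrightarrow> 0) (at 0)"
  proof (rule Lim_null_comparison)
    show "\<forall>\<^sub>F t in at 0. norm (norm (f t - f 0 - t *\<^sub>R D) / norm t) \<le> K * \<bar>t\<bar>"
      using eventually_at_ball'[OF zero_less_one, of 0 UNIV]
    proof (rule eventually_mono)
      fix t :: real
      assume "t \<in> ball 0 1 \<and> t \<noteq> 0 \<and> t \<in> UNIV"
      then show "norm (norm (f t - f 0 - t *\<^sub>R D) / norm t) \<le> K * \<bar>t\<bar>"
        using assms[of t] by (simp add: divide_le_eq power2_eq_square mult.assoc)
    qed
    have "((\<lambda>t::real. K * \<bar>t\<bar>) \<longlongrightarrow> K * \<bar>0\<bar>) (at 0)"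
      by (intro tendsto_intros)
    then show "((\<lambda>t::real. K * \<bar>t\<bar>) \<longlongrightarrow> 0) (at 0)" by simp
  qed
  then show ?thesis
    by (simp add: has_vector_derivative_def has_derivative_iff_norm bounded_linear_scaleR_left)
qed

text \<open>
  Termwise differentiation at one point needs no uniform convergence of the derived series: the
  remainder of each exponential is at most quadratic in \<open>t\<close>, and the quadratic bounds can be summed.
\<close>
lemma trigonometric_series_has_vector_derivative:
  fixes a :: "'k \<Rightarrow> real" and c :: "'k \<Rightarrow> complex"
  assumes c: "(\<lambda>k. norm (c k)) summable_on X"
    and ac: "(\<lambda>k. (a k)\<^sup>2 * norm (c k)) summable_on X"
  shows "((\<lambda>t. \<Sum>\<^sub>\<infinity>k\<in>X. exp (\<i> * of_real (a k * t)) * c k)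
      has_vector_derivative (\<Sum>\<^sub>\<infinity>k\<in>X. \<i> * of_real (a k) * c k)) (at 0)"
proof (rule quadratic_bound_has_vector_derivative)
  fix t :: real
  let ?R = "\<lambda>k. exp (\<i> * of_real (a k * t)) * c k - c k - t *\<^sub>R (\<i> * of_real (a k) * c k)"
  have s1: "(\<lambda>k. exp (\<i> * of_real (a k * t)) * c k) summable_on X"
    by (rule abs_summable_summable) (use c in \<open>simp add: norm_mult\<close>)
  have s2: "c summable_on X"
    using c by (rule abs_summable_summable)
  have "\<bar>a k\<bar> * norm (c k) \<le> norm (c k) + (a k)\<^sup>2 * norm (c k)" for k
  proof -
    have "\<bar>a k\<bar> \<le> 1 + (a k)\<^sup>2"
      using zero_le_power2[of "\<bar>a k\<bar> - 1"] unfolding power2_diff by simp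
    from mult_right_mono[OF this, of "norm (c k)"] show ?thesis by (simp add: algebra_simps)
  qed
  then have s3: "(\<lambda>k. \<i> * of_real (a k) * c k) summable_on X"
    by (intro summable_on_norm_bound[OF summable_on_add[OF c ac]]) (auto simp: norm_mult)
  have R: "(?R has_sum ((\<Sum>\<^sub>\<infinity>k\<in>X. exp (\<i> * of_real (a k * t)) * c k)
      - (\<Sum>\<^sub>\<infinity>k\<in>X. c k) - t *\<^sub>R (\<Sum>\<^sub>\<infinity>k\<in>X. \<i> * of_real (a k) * c k))) X"
    unfolding diff_conv_add_uminus
    by (intro has_sum_add has_sum_uminusI has_sum_scaleR has_sum_infsum s1 s2 s3)
  have "norm (?R k) \<le> t\<^sup>2 * ((a k)\<^sup>2 * norm (c k))" for k
  proof -
    have "?R k = (exp (\<i> * of_real (a k * t)) - (\<Sum>i\<le>1. (\<i> * of_real (a k * t)) ^ i / fact i)) * c k"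
      by (simp add: algebra_simps scaleR_conv_of_real)
    also have "norm \<dots> \<le> (a k * t)\<^sup>2 * norm (c k)"
      unfolding norm_mult using Taylor_exp[of "\<i> * of_real (a k * t)" 1]
      by (intro mult_right_mono) (auto simp: norm_mult power2_eq_square abs_mult)
    finally show ?thesis by (simp add: power_mult_distrib mult_ac)
  qed
  then have "norm ((\<Sum>\<^sub>\<infinity>k\<in>X. exp (\<i> * of_real (a k * t)) * c k)
      - (\<Sum>\<^sub>\<infinity>k\<in>X. c k) - t *\<^sub>R (\<Sum>\<^sub>\<infinity>k\<in>X. \<i> * of_real (a k) * c k))
      \<le> t\<^sup>2 * (\<Sum>\<^sub>\<infinity>k\<in>X. (a k)\<^sup>2 * norm (c k))"
    by (intro norm_infsum_le[OF R has_sum_cmult_right[OF has_sum_infsum[OF ac]]])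
  then show "norm ((\<Sum>\<^sub>\<infinity>k\<in>X. exp (\<i> * of_real (a k * t)) * c k)
      - (\<Sum>\<^sub>\<infinity>k\<in>X. exp (\<i> * of_real (a k * 0)) * c k) - t *\<^sub>R (\<Sum>\<^sub>\<infinity>k\<in>X. \<i> * of_real (a k) * c k))
      \<le> (\<Sum>\<^sub>\<infinity>k\<in>X. (a k)\<^sup>2 * norm (c k)) * t\<^sup>2"
    by (simp add: mult.commute)
qed

lemma partial_deriv_synth:
  fixes w :: "'d::finite coeffs"
  assumes w: "rapid w"
  shows "partial_deriv s (\<lambda>y. synth w y $ r) x
    = (\<Sum>\<^sub>\<infinity>h. \<i> * of_int (h $ s) * fmode h x * w h $ r)"
proof -
  have nth: "synth w y $ r = (\<Sum>\<^sub>\<infinity>h. fmode h y * w h $ r)" for y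
    unfolding synth_def
    using infsum_linear[OF bounded_linear_vec_nth[of r] summable_synth[OF rapid_norm_summable[OF w], of y]]
    by simp
  have s0: "(\<lambda>h. norm (fmode h x * w h $ r)) summable_on UNIV"
    by (rule summable_on_comparison_test[OF rapid_norm_summable[OF w]])
       (auto simp: norm_mult Finite_Cartesian_Product.norm_nth_le)
  have s2: "(\<lambda>h. (of_int (h $ s))\<^sup>2 * norm (fmode h x * w h $ r)) summable_on UNIV"
  proof (rule summable_on_comparison_test[OF rapid_abs_summable[OF w, of 2]])
    fix h :: "int ^ 'd"
    have "\<bar>real_of_int (h $ s)\<bar> \<le> weight h"
      using abs_nth_le_wave_norm wave_norm_le_weight by (rule order.trans)
    then have "(real_of_int (h $ s))\<^sup>2 \<le> (weight h)\<^sup>2"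
      by (metis power2_abs power_mono abs_ge_zero)
    then show "(of_int (h $ s))\<^sup>2 * norm (fmode h x * w h $ r) \<le> weight h ^ 2 * norm (w h)"
      by (intro mult_mono) (auto simp: norm_mult Finite_Cartesian_Product.norm_nth_le)
  qed auto
  have "fmode h (x + t *\<^sub>R axis s 1) = fmode h x * exp (\<i> * of_real (of_int (h $ s) * t))" for h t
  proof -
    have "t *\<^sub>R axis s 1 = (axis s t :: real ^ 'd)" by (simp add: vec_eq_iff axis_def)
    then show ?thesis by (simp add: fmode_add_right fmode_axis)
  qed
  then have "(\<lambda>t. synth w (x + t *\<^sub>R axis s 1) $ r)
      = (\<lambda>t. \<Sum>\<^sub>\<infinity>h. exp (\<i> * of_real (of_int (h $ s) * t)) * (fmode h x * w h $ r))"
    unfolding nth by (simp add: mult_ac)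
  with trigonometric_series_has_vector_derivative[OF s0 s2]
  have "((\<lambda>t. synth w (x + t *\<^sub>R axis s 1) $ r) has_vector_derivative
      (\<Sum>\<^sub>\<infinity>h. \<i> * of_real (of_int (h $ s)) * (fmode h x * w h $ r))) (at 0)"
    by simp
  then show ?thesis
    unfolding partial_deriv_def by (simp add: vector_derivative_at mult.assoc)
qed

text \<open>
  The Fourier coefficients of the advection term: a convolution in which the second factor is
  differentiated in the direction of the first one.
\<close>
definition conv :: "'d::finite coeffs \<Rightarrow> 'd coeffs \<Rightarrow> 'd coeffs" where
  "conv v w k = (\<Sum>\<^sub>\<infinity>h. (\<i> * bdot (v (k - h)) (vec_of_int h)) *s w h)"

lemma norm_conv_term_le:
  fixes v w :: "'d::finite coeffs"
  shows "norm ((\<i> * bdot (v k) (vec_of_int h)) *s w h)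
    \<le> real CARD('d) * (norm (v k) * (weight h * norm (w h)))"
proof -
  have "norm (bdot (v k) (vec_of_int h)) \<le> real CARD('d) * (norm (v k) * weight h)"
    using norm_bdot_le[of "v k" "vec_of_int h"] wave_norm_le_weight[of h]
    by (smt (verit, best) mult_left_mono norm_ge_zero norm_vec_of_int of_nat_0_le_iff)
  from mult_right_mono[OF this, of "norm (w h)"] show ?thesis
    by (simp add: norm_smult_vec norm_mult mult_ac)
qed

lemma conv_summable:
  fixes v w :: "'d::finite coeffs"
  assumes "rapid v" "rapid w"
  shows "(\<lambda>h. (\<i> * bdot (v (k - h)) (vec_of_int h)) *s w h) summable_on UNIV"
proof -
  obtain C where C: "\<And>k. weight k ^ 0 * norm (v k) \<le> C"
    by (rule rapid_onE[OF assms(1), where n = 0]) auto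
  have "(\<lambda>h. real CARD('d) * (C * (weight h * norm (w h)))) summable_on UNIV"
    using rapid_abs_summable[OF assms(2), of 1] by (intro summable_on_cmult_right) simp
  then show ?thesis
  proof (rule summable_on_norm_bound)
    fix h
    have "real CARD('d) * (norm (v (k - h)) * (weight h * norm (w h)))
        \<le> real CARD('d) * (C * (weight h * norm (w h)))"
      using C[of "k - h"] by (intro mult_left_mono mult_right_mono) auto
    with norm_conv_term_le show "norm ((\<i> * bdot (v (k - h)) (vec_of_int h)) *s w h)
        \<le> real CARD('d) * (C * (weight h * norm (w h)))"
      by (rule order.trans)
  qed
qed

lemma bij_betw_minus: "bij_betw (\<lambda>k. k - h) UNIV (UNIV :: 'a::ab_group_add set)"
  by (rule bij_betwI[of _ _ _ "\<lambda>k. k + h"]) auto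

text \<open>
  This majorant of the double series justifies the exchange of summations in the product of two
  Fourier series.
\<close>
lemma conv_summable_pairs:
  fixes v w :: "'d::finite coeffs"
  assumes "rapid v" "rapid w"
  shows "(\<lambda>(h, k). real CARD('d) * (norm (v (k - h)) * (weight h * norm (w h)))) summable_on UNIV \<times> UNIV"
proof (rule summable_on_SigmaI)
  let ?V = "\<Sum>\<^sub>\<infinity>k. norm (v k)"
  fix h
  have "((\<lambda>k. norm (v (k - h))) has_sum ?V) UNIV"
    using has_sum_infsum[OF rapid_norm_summable[OF assms(1)]]
    by (subst has_sum_reindex_bij_betw[OF bij_betw_minus])
  then show "((\<lambda>k. case (h, k) of (h, k) \<Rightarrow> real CARD('d) * (norm (v (k - h)) * (weight h * norm (w h))))
      has_sum real CARD('d) * (?V * (weight h * norm (w h)))) UNIV"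
    unfolding prod.case by (intro has_sum_cmult_right has_sum_cmult_left)
next
  show "(\<lambda>h. real CARD('d) * ((\<Sum>\<^sub>\<infinity>k. norm (v k)) * (weight h * norm (w h)))) summable_on UNIV"
    using rapid_abs_summable[OF assms(2), of 1] by (intro summable_on_cmult_right) simp
qed auto

text \<open>
  The product of the two absolutely convergent series is rearranged by the total wave vector
  \<open>k = l + h\<close>.
\<close>
lemma advect_synth:
  fixes v w :: "'d::finite coeffs"
  assumes v: "rapid v" and w: "rapid w"
  shows "advect (synth v) (synth w) = synth (conv v w)"
proof
  fix x
  let ?F = "\<lambda>k h. fmode k x *s ((\<i> * bdot (v (k - h)) (vec_of_int h)) *s w h)"
  have pairs: "(\<lambda>(h, k). norm (?F k h)) summable_on UNIV \<times> UNIV"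
    by (rule summable_on_comparison_test[OF conv_summable_pairs[OF v w]])
       (auto simp only: split_paired_all prod.case norm_fmode_smult norm_conv_term_le norm_ge_zero)
  then have pairs': "(\<lambda>(h, k). ?F k h) summable_on UNIV \<times> UNIV"
    by (rule summable_on_norm_bound) auto
  note row = conv_summable[OF v w]
  have sd: "(\<lambda>h. (\<i> * of_int (h $ s) * fmode h x) *s w h) summable_on UNIV" for s
  proof (rule summable_on_norm_bound[OF rapid_abs_summable[OF w, of 1]])
    fix h :: "int ^ 'd"
    have "\<bar>real_of_int (h $ s)\<bar> \<le> weight h"
      using abs_nth_le_wave_norm wave_norm_le_weight by (rule order.trans)
    then show "norm ((\<i> * of_int (h $ s) * fmode h x) *s w h) \<le> weight h ^ 1 * norm (w h)"
      by (auto simp: norm_smult_vec norm_mult intro: mult_right_mono)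
  qed
  have "advect (synth v) (synth w) x
      = (\<Sum>s\<in>UNIV. synth v x $ s *s (\<Sum>\<^sub>\<infinity>h. (\<i> * of_int (h $ s) * fmode h x) *s w h))"
  proof -
    have "(\<Sum>\<^sub>\<infinity>h. (\<i> * of_int (h $ s) * fmode h x) *s w h) $ r
        = partial_deriv s (\<lambda>y. synth w y $ r) x" for s r
      using infsum_linear[OF bounded_linear_vec_nth[of r] sd[of s]]
      by (simp add: partial_deriv_synth[OF w])
    then show ?thesis by (simp add: advect_def vec_eq_iff)
  qed
  also have "\<dots> = (\<Sum>s\<in>UNIV. \<Sum>\<^sub>\<infinity>h. synth v x $ s *s ((\<i> * of_int (h $ s) * fmode h x) *s w h))"
    by (intro sum.cong refl infsum_linear[OF bounded_linear_smult_right sd, symmetric])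
  also have "\<dots> = (\<Sum>\<^sub>\<infinity>h. \<Sum>s\<in>UNIV. synth v x $ s *s ((\<i> * of_int (h $ s) * fmode h x) *s w h))"
    by (intro infsumI[symmetric] has_sum_sum has_sum_infsum
        summable_on_bounded_linear[OF bounded_linear_smult_right sd, unfolded o_def])
  also have "\<dots> = (\<Sum>\<^sub>\<infinity>h. (\<i> * bdot (synth v x) (vec_of_int h) * fmode h x) *s w h)"
    by (rule infsum_cong) (simp add: vec_eq_iff bdot_def sum_distrib_left sum_distrib_right
        vec_of_int_def mult_ac)
  also have "\<dots> = (\<Sum>\<^sub>\<infinity>h. \<Sum>\<^sub>\<infinity>l. ?F (l + h) h)"
  proof (rule infsum_cong)
    fix h :: "int ^ 'd"
    have lin: "bounded_linear (\<lambda>z. (\<i> * bdot z (vec_of_int h) * fmode h x) *s w h)"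
      by (intro bounded_linear_compose[OF bounded_linear_smult_left]
          bounded_linear_mult_left bounded_linear_compose[OF bounded_linear_mult_left]
          bounded_linear_compose[OF bounded_linear_mult_right]
          bounded_bilinear.bounded_linear_left[OF bounded_bilinear_bdot])
    show "(\<i> * bdot (synth v x) (vec_of_int h) * fmode h x) *s w h = (\<Sum>\<^sub>\<infinity>l. ?F (l + h) h)"
      unfolding synth_def
      by (subst infsum_linear[OF lin summable_synth[OF rapid_norm_summable[OF v]], symmetric])
         (simp add: bdot_smult_left fmode_add_left vector_smult_assoc mult_ac)
  qed
  also have "\<dots> = (\<Sum>\<^sub>\<infinity>h. \<Sum>\<^sub>\<infinity>k. ?F k h)"
  proof (rule infsum_cong)
    fix h :: "int ^ 'd"
    show "(\<Sum>\<^sub>\<infinity>l. ?F (l + h) h) = (\<Sum>\<^sub>\<infinity>k. ?F k h)"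
      using infsum_reindex_bij_betw[OF bij_betw_minus[of h], of "\<lambda>l. ?F (l + h) h"] by simp
  qed
  also have "\<dots> = (\<Sum>\<^sub>\<infinity>k. \<Sum>\<^sub>\<infinity>h. ?F k h)"
    using pairs' by (rule infsum_swap_banach)
  also have "\<dots> = synth (conv v w) x"
    unfolding synth_def conv_def
    by (simp only: infsum_linear[OF bounded_linear_smult_right row])
  finally show "advect (synth v) (synth w) x = synth (conv v w) x" .
qed

text \<open>
  By submultiplicativity, the weight of the output wave vector can be distributed over the two
  factors; the first is then bounded uniformly and the second is summed.  The one extra power on the
  second factor pays for its derivative.
\<close>
lemma rapid_on_conv:
  fixes f g :: "'s \<Rightarrow> 'd::finite coeffs"
  assumes f: "rapid_on A f" and g: "rapid_on A g"
  shows "rapid_on A (\<lambda>s. conv (f s) (g s))"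
  unfolding rapid_on_def
proof
  fix n
  obtain C where C: "C \<ge> 0" "\<And>s k. s \<in> A \<Longrightarrow> weight k ^ n * norm (f s k) \<le> C"
    by (rule rapid_onE[OF f, where n = n]) (rule that)
  obtain M where M: "M summable_on UNIV" "\<And>k. 0 \<le> M k"
    "\<And>s k. s \<in> A \<Longrightarrow> weight k ^ (n + 1) * norm (g s k) \<le> M k"
    by (rule rapid_on_dominated[OF g, where n = "n + 1"]) (rule that)
  let ?K = "real CARD('d) * C"
  have "weight k ^ n * norm (conv (f s) (g s) k) \<le> ?K * infsum M UNIV" if s: "s \<in> A" for s k
  proof -
    let ?t = "\<lambda>h. (\<i> * bdot (f s (k - h)) (vec_of_int h)) *s g s h"
    have le: "norm (weight k ^ n *\<^sub>R ?t h) \<le> ?K * M h" for h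
    proof -
      have "weight k ^ n \<le> weight (k - h) ^ n * weight h ^ n"
        using power_mono[OF weight_mult, of k n h] by (simp add: power_mult_distrib)
      then have "norm (weight k ^ n *\<^sub>R ?t h) \<le> (weight (k - h) ^ n * weight h ^ n) *
          (real CARD('d) * (norm (f s (k - h)) * (weight h * norm (g s h))))"
        unfolding norm_scaleR
        by (intro mult_mono norm_conv_term_le) auto
      also have "\<dots> = real CARD('d) * ((weight (k - h) ^ n * norm (f s (k - h))) *
          (weight h ^ (n + 1) * norm (g s h)))"
        by (simp add: mult_ac)
      also have "\<dots> \<le> real CARD('d) * (C * M h)"
        using C M s by (intro mult_left_mono mult_mono) auto
      finally show ?thesis by (simp add: mult_ac)
    qed
    have sM: "(\<lambda>h. ?K * M h) summable_on UNIV"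
      by (intro summable_on_cmult_right M)
    have sT: "(\<lambda>h. weight k ^ n *\<^sub>R ?t h) summable_on UNIV"
      using sM by (rule summable_on_norm_bound) (rule le)
    have "weight k ^ n *\<^sub>R conv (f s) (g s) k = (\<Sum>\<^sub>\<infinity>h. weight k ^ n *\<^sub>R ?t h)"
      unfolding conv_def by (simp add: infsum_scaleR_right)
    then have "weight k ^ n * norm (conv (f s) (g s) k) = norm (\<Sum>\<^sub>\<infinity>h. weight k ^ n *\<^sub>R ?t h)"
      by (metis abs_of_nonneg norm_scaleR weight_nonneg zero_le_power)
    also have "\<dots> \<le> (\<Sum>\<^sub>\<infinity>h. ?K * M h)"
      by (rule norm_infsum_le[OF has_sum_infsum[OF sT] has_sum_infsum[OF sM] le])
    finally show ?thesis by (simp add: infsum_cmult_right')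
  qed
  then show "\<exists>C. \<forall>s\<in>A. \<forall>k. weight k ^ n * norm (conv (f s) (g s) k) \<le> C" by blast
qed

lemma PP_eq:
  assumes "rapid v" "rapid w"
  shows "PP v w = (\<lambda>k. - leray (conv v w) k)"
  unfolding PP_def advect_synth[OF assms]
  by (subst fourier_synth[OF rapid_norm_summable[OF rapid_on_conv[OF assms]]]) simp

section \<open>Smooth solenoidal fields\<close>

text \<open>
  The algebraic constraints common to all the Sobolev spaces, zero mean included.
\<close>
definition real_solenoidal :: "'d::finite coeffs \<Rightarrow> bool" where
  "real_solenoidal v \<longleftrightarrow> (\<forall>k r. cnj (v k $ r) = v (- k) $ r) \<and>
     (\<forall>k. bdot (vec_of_int k) (v k) = 0) \<and> v 0 = 0"

text \<open>
  The square is split into two factors because they are estimated differently: the weighted one is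
  summed, the other one is bounded by a constant.
\<close>
lemma Hspace_term_le:
  assumes "k \<noteq> 0" "2 * n \<le> real m"
  shows "wave_norm k powr (2 * n) * (norm z)\<^sup>2 \<le> weight k ^ m * norm z * norm z"
proof -
  have w: "1 \<le> wave_norm k" using assms(1) by (rule wave_norm_ge_1)
  then have "wave_norm k powr (2 * n) \<le> wave_norm k powr real m"
    using assms(2) by (intro powr_mono)
  also have "\<dots> = wave_norm k ^ m"
    using w by (intro powr_realpow) linarith
  also have "\<dots> \<le> weight k ^ m"
    by (intro power_mono wave_norm_le_weight) auto
  finally have "wave_norm k powr (2 * n) * (norm z)\<^sup>2 \<le> weight k ^ m * (norm z)\<^sup>2"
    by (rule mult_right_mono) auto
  then show ?thesis by (simp add: power2_eq_square mult.assoc)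
qed

lemma rapid_Hspace_summable:
  assumes "rapid v"
  shows "(\<lambda>k. wave_norm k powr (2 * n) * (norm (v k))\<^sup>2) summable_on (- {0})"
proof -
  obtain C where C: "C \<ge> 0" "\<And>k. weight k ^ 0 * norm (v k) \<le> C"
    by (rule rapid_onE[OF assms, where n = 0]) auto
  obtain m :: nat where m: "2 * n \<le> real m"
    using real_arch_simple by blast
  have "(\<lambda>k. (weight k ^ m * norm (v k)) * C) summable_on UNIV"
    by (intro summable_on_cmult_left rapid_abs_summable assms)
  then have "(\<lambda>k. (weight k ^ m * norm (v k)) * C) summable_on (- {0})"
    by (rule summable_on_subset) auto
  then show ?thesis
  proof (rule summable_on_comparison_test)
    fix k :: "int ^ 'a"
    assume "k \<in> - {0}"
    then have "wave_norm k powr (2 * n) * (norm (v k))\<^sup>2 \<le> (weight k ^ m * norm (v k)) * norm (v k)"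
      using Hspace_term_le[OF _ m] by auto
    also have "\<dots> \<le> (weight k ^ m * norm (v k)) * C"
      using C(2)[of k] by (intro mult_left_mono) auto
    finally show "wave_norm k powr (2 * n) * (norm (v k))\<^sup>2 \<le> (weight k ^ m * norm (v k)) * C" .
  qed auto
qed

text \<open>
  Each term of the convergent sum defining a Sobolev norm is bounded by the whole sum, which gives
  decay; conversely, rapid decay beats every Sobolev weight.
\<close>
lemma Hinf_iff: "v \<in> Hinf \<longleftrightarrow> real_solenoidal v \<and> rapid v"
proof
  assume v: "v \<in> Hinf"
  then have rs: "real_solenoidal v"
    by (auto simp: Hinf_def Hspace_def real_solenoidal_def)
  moreover have "\<exists>C. \<forall>k. weight k ^ n * norm (v k) \<le> C" for n
  proof -
    let ?g = "\<lambda>k. wave_norm k powr (2 * real n) * (norm (v k))\<^sup>2"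
    have sum: "?g summable_on (- {0})"
      using v by (auto simp: Hinf_def Hspace_def)
    define S where "S = infsum ?g (- {0})"
    have "weight k ^ n * norm (v k) \<le> 2 ^ n * sqrt S" for k
    proof (cases "k = 0")
      case True
      have "0 \<le> S" unfolding S_def by (rule infsum_nonneg) auto
      then show ?thesis using True rs by (simp add: real_solenoidal_def)
    next
      case False
      then have w: "1 \<le> wave_norm k" by (rule wave_norm_ge_1)
      have "(wave_norm k ^ n * norm (v k))\<^sup>2 = ?g k"
        using w powr_realpow[of "wave_norm k" "2 * n"]
        by (simp add: power_mult_distrib power_mult[symmetric] mult.commute)
      also have "?g k \<le> S"
        using finite_sum_le_infsum[OF sum, of "{k}"] False by (simp add: S_def)
      finally have le: "wave_norm k ^ n * norm (v k) \<le> sqrt S"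
        by (rule real_le_rsqrt)
      have "weight k ^ n \<le> (2 * wave_norm k) ^ n"
        using w by (intro power_mono) (auto simp: weight_def)
      then have "weight k ^ n * norm (v k) \<le> (2 * wave_norm k) ^ n * norm (v k)"
        by (intro mult_right_mono) auto
      also have "\<dots> = 2 ^ n * (wave_norm k ^ n * norm (v k))"
        by (simp add: power_mult_distrib)
      also have "\<dots> \<le> 2 ^ n * sqrt S"
        using le by simp
      finally show ?thesis .
    qed
    then show ?thesis by blast
  qed
  ultimately show "real_solenoidal v \<and> rapid v"
    by (simp add: rapid_on_def)
next
  assume "real_solenoidal v \<and> rapid v"
  then show "v \<in> Hinf"
    using rapid_Hspace_summable by (auto simp: Hinf_def Hspace_def real_solenoidal_def)
qed

lemma real_solenoidal_add:
  "real_solenoidal v \<Longrightarrow> real_solenoidal w \<Longrightarrow> real_solenoidal (\<lambda>k. v k + w k)"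
  by (simp add: real_solenoidal_def bdot_add_right)

lemma real_solenoidal_sum:
  "(\<And>i. i \<in> I \<Longrightarrow> real_solenoidal (f i)) \<Longrightarrow> real_solenoidal (\<lambda>k. \<Sum>i\<in>I. f i k)"
proof (induction I rule: infinite_finite_induct)
  case (insert i I)
  then show ?case using real_solenoidal_add[of "f i" "\<lambda>k. \<Sum>i\<in>I. f i k"] by simp
qed (simp_all add: real_solenoidal_def bdot_def)

lemma real_solenoidal_heat: "real_solenoidal v \<Longrightarrow> real_solenoidal (heat t v)"
  by (simp add: real_solenoidal_def heat_def bdot_scaleR_right)

lemma conv_nth:
  assumes "rapid v" "rapid w"
  shows "conv v w k $ r = (\<Sum>\<^sub>\<infinity>h. \<i> * bdot (v (k - h)) (vec_of_int h) * w h $ r)"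
  using infsum_linear[OF bounded_linear_vec_nth[of r] conv_summable[OF assms, of k]]
  by (simp add: conv_def)

text \<open>
  The zero mode of the advection term vanishes because the first field is solenoidal; the
  projection does nothing to that mode.
\<close>
lemma real_solenoidal_PP:
  fixes v w :: "'d::finite coeffs"
  assumes "rapid v" "rapid w" "real_solenoidal v" "real_solenoidal w"
  shows "real_solenoidal (PP v w)"
proof -
  have v: "cnj (v k $ r) = v (- k) $ r" "bdot (vec_of_int k) (v k) = 0" for k r
    using assms(3) by (auto simp: real_solenoidal_def)
  have w: "cnj (w k $ r) = w (- k) $ r" for k r
    using assms(4) by (auto simp: real_solenoidal_def)
  have cnj: "cnj (conv v w k $ r) = conv v w (- k) $ r" for k r
  proof -
    have "cnj (conv v w k $ r) = (\<Sum>\<^sub>\<infinity>h. cnj (\<i> * bdot (v (k - h)) (vec_of_int h) * w h $ r))"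
      by (simp only: conv_nth[OF assms(1,2)] infsum_cnj)
    also have "\<dots> = (\<Sum>\<^sub>\<infinity>h. \<i> * bdot (v (- k - (- h))) (vec_of_int (- h)) * w (- h) $ r)"
      by (rule infsum_cong) (simp add: bdot_def vec_of_int_def v w sum_negf)
    also have "\<dots> = conv v w (- k) $ r"
      unfolding conv_nth[OF assms(1,2)]
      by (rule infsum_reindex_bij_betw[where f = "\<lambda>h. \<i> * bdot (v (- k - h)) (vec_of_int h) * w h $ r"])
         (auto intro: bij_betwI[of _ _ _ uminus])
    finally show ?thesis .
  qed
  have zero: "conv v w 0 = 0"
  proof -
    have "bdot (v (0 - h)) (vec_of_int h) = 0" for h
    proof -
      have "bdot (v (0 - h)) (vec_of_int h) = - bdot (vec_of_int (- h)) (v (- h))"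
        by (simp add: bdot_commute[of "v _"] bdot_minus_left)
      then show ?thesis using v(2)[of "- h"] by simp
    qed
    then show ?thesis by (simp add: conv_def del: diff_0)
  qed
  have PPk: "PP v w k = - leray (conv v w) k" for k
    by (simp add: PP_eq assms)
  have "bdot (vec_of_int k) (PP v w k) = 0" for k
  proof (cases "k = 0")
    case False
    then have "wave_norm k \<noteq> 0" using wave_norm_ge_1[of k] by linarith
    then have "bdot (vec_of_int k) (leray (conv v w) k) = 0"
      by (simp add: leray_def bdot_diff_right bdot_smult_right bdot_vec_of_int_self)
    moreover have "bdot a (- b) = - bdot a b" for a b :: "complex ^ 'd"
      by (simp add: bdot_def sum_negf)
    ultimately show ?thesis by (simp add: PPk)
  qed simp
  moreover have "cnj (PP v w k $ r) = PP v w (- k) $ r" for k r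
    by (simp add: PPk leray_def bdot_def cnj vec_of_int_def sum_negf)
  moreover have "PP v w 0 = 0"
    by (simp add: PPk leray_def zero)
  ultimately show ?thesis by (simp add: real_solenoidal_def)
qed

lemma norm_leray_le:
  fixes v :: "'d::finite coeffs"
  shows "norm (leray v k) \<le> (1 + real CARD('d)) * norm (v k)"
proof (cases "k = 0")
  case False
  then have w: "1 \<le> wave_norm k" by (rule wave_norm_ge_1)
  have "norm ((bdot (vec_of_int k) (v k) / of_real ((wave_norm k)\<^sup>2)) *s (vec_of_int k :: complex ^ 'd))
      = norm (bdot (vec_of_int k) (v k)) / wave_norm k"
    using w by (simp add: norm_smult_vec norm_divide norm_mult norm_vec_of_int norm_power power2_eq_square)
  also have "\<dots> \<le> real CARD('d) * norm (v k)"
    using w norm_bdot_le[of "vec_of_int k" "v k"]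
    by (simp add: norm_vec_of_int divide_le_eq mult_ac)
  finally have "norm (v k) + norm ((bdot (vec_of_int k) (v k) / of_real ((wave_norm k)\<^sup>2)) *s (vec_of_int k :: complex ^ 'd))
      \<le> (1 + real CARD('d)) * norm (v k)"
    by (simp add: distrib_right)
  with norm_triangle_ineq4 show ?thesis
    unfolding leray_def by (rule order.trans)
qed (simp add: leray_def distrib_right)

section \<open>Curves of smooth fields and their integrals\<close>

text \<open>
  On bounded sets of rapidly decreasing coefficients, coefficientwise convergence and convergence in
  all Sobolev norms coincide.  Hence these are continuous curves in \<open>Hinf\<close> with bounded range, in a
  form that can be checked one coefficient at a time.
\<close>
definition smooth_curve :: "real set \<Rightarrow> (real \<Rightarrow> 'd::finite coeffs) \<Rightarrow> bool" where
  "smooth_curve A f \<longleftrightarrow> rapid_on A f \<and> (\<forall>s\<in>A. real_solenoidal (f s)) \<and>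
     (\<forall>k. continuous_on A (\<lambda>s. f s k))"

lemma smooth_curve_Hinf: "smooth_curve A f \<Longrightarrow> s \<in> A \<Longrightarrow> f s \<in> Hinf"
  by (auto simp: smooth_curve_def Hinf_iff intro: rapid_onD)

lemma smooth_curve_subset: "smooth_curve A f \<Longrightarrow> B \<subseteq> A \<Longrightarrow> smooth_curve B f"
  unfolding smooth_curve_def rapid_on_def by (meson continuous_on_subset subsetD)

lemma smooth_curve_cong:
  assumes "\<And>s. s \<in> A \<Longrightarrow> f s = g s"
  shows "smooth_curve A f \<longleftrightarrow> smooth_curve A g"
  unfolding smooth_curve_def rapid_on_def using assms by (simp cong: continuous_on_cong)

lemma smooth_curve_sum:
  "(\<And>i. i \<in> I \<Longrightarrow> smooth_curve A (f i)) \<Longrightarrow> smooth_curve A (\<lambda>s k. \<Sum>i\<in>I. f i s k)"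
  unfolding smooth_curve_def
  by (auto intro!: rapid_on_sum real_solenoidal_sum continuous_on_sum)

lemma norm_heat_le: "0 \<le> t \<Longrightarrow> norm (heat t v k) \<le> norm (v k)"
  by (simp add: heat_def mult_left_le_one_le)

lemma smooth_curve_heat_orbit:
  assumes "v \<in> Hinf"
  shows "smooth_curve {0..T} (\<lambda>t. heat t v)"
  unfolding smooth_curve_def
proof (intro conjI ballI allI)
  have v: "real_solenoidal v" "rapid v" using assms by (auto simp: Hinf_iff)
  show "rapid_on {0..T} (\<lambda>t. heat t v)"
    by (rule rapid_on_le[OF rapid_on_const[OF v(2)], where c = 1]) (simp add: norm_heat_le)
  show "real_solenoidal (heat t v)" for t
    using v by (intro real_solenoidal_heat)
  show "continuous_on {0..T} (\<lambda>t. heat t v k)" for k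
    unfolding heat_def by (intro continuous_intros)
qed

lemma smooth_curve_heat:
  assumes "smooth_curve {0..t} f"
  shows "smooth_curve {0..t} (\<lambda>s. heat (t - s) (f s))"
  unfolding smooth_curve_def
proof (intro conjI ballI allI)
  have f: "rapid_on {0..t} f" "\<And>s. s \<in> {0..t} \<Longrightarrow> real_solenoidal (f s)"
    "\<And>k. continuous_on {0..t} (\<lambda>s. f s k)" using assms by (auto simp: smooth_curve_def)
  show "rapid_on {0..t} (\<lambda>s. heat (t - s) (f s))"
    by (rule rapid_on_le[OF f(1), where c = 1]) (simp add: norm_heat_le)
  show "real_solenoidal (heat (t - s) (f s))" if "s \<in> {0..t}" for s
    using f that by (intro real_solenoidal_heat)
  show "continuous_on {0..t} (\<lambda>s. heat (t - s) (f s) k)" for k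
    unfolding heat_def by (intro continuous_intros f)
qed

text \<open>
  Continuity of a convolution in time is dominated convergence, with the majorant supplied by
  uniform decay.
\<close>
lemma smooth_curve_PP:
  fixes f g :: "real \<Rightarrow> 'd::finite coeffs"
  assumes "smooth_curve A f" "smooth_curve A g"
  shows "smooth_curve A (\<lambda>s. PP (f s) (g s))"
proof -
  have f: "rapid_on A f" "\<And>s. s \<in> A \<Longrightarrow> real_solenoidal (f s)"
    "\<And>k. continuous_on A (\<lambda>s. f s k)" using assms(1) by (auto simp: smooth_curve_def)
  have g: "rapid_on A g" "\<And>s. s \<in> A \<Longrightarrow> real_solenoidal (g s)"
    "\<And>k. continuous_on A (\<lambda>s. g s k)" using assms(2) by (auto simp: smooth_curve_def)
  have eq: "PP (f s) (g s) = (\<lambda>k. - leray (conv (f s) (g s)) k)" if "s \<in> A" for s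
    using f(1) g(1) that by (intro PP_eq rapid_onD)
  have cont: "continuous_on A (\<lambda>s. conv (f s) (g s) k)" for k
  proof -
    obtain C where C: "C \<ge> 0" "\<And>s k. s \<in> A \<Longrightarrow> weight k ^ 0 * norm (f s k) \<le> C"
      by (rule rapid_onE[OF f(1), where n = 0]) (rule that)
    obtain M where M: "M summable_on UNIV" "\<And>k. 0 \<le> M k"
      "\<And>s k. s \<in> A \<Longrightarrow> weight k ^ 1 * norm (g s k) \<le> M k"
      by (rule rapid_on_dominated[OF g(1), where n = 1]) (rule that)
    show ?thesis
      unfolding continuous_on_def conv_def
    proof (intro ballI tendsto_infsum_dominated)
      fix s h assume "s \<in> A"
      then have "((\<lambda>s. f s (k - h)) \<longlongrightarrow> f s (k - h)) (at s within A)"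
        "((\<lambda>s. g s h) \<longlongrightarrow> g s h) (at s within A)"
        using f(3) g(3) by (auto simp: continuous_on_def)
      then show "((\<lambda>s. (\<i> * bdot (f s (k - h)) (vec_of_int h)) *s g s h) \<longlongrightarrow>
          (\<i> * bdot (f s (k - h)) (vec_of_int h)) *s g s h) (at s within A)"
        by (intro bounded_bilinear.tendsto[OF bounded_bilinear_smult] tendsto_intros
            bounded_bilinear.tendsto[OF bounded_bilinear_bdot])
    next
      fix s
      have "norm ((\<i> * bdot (f s (k - h)) (vec_of_int h)) *s g s h) \<le> real CARD('d) * (C * M h)"
        if "s \<in> A" for s h
        using C M that
        by (intro order.trans[OF norm_conv_term_le] mult_left_mono mult_mono) auto
      then show "\<forall>\<^sub>F s in at s within A. \<forall>h\<in>UNIV.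
          norm ((\<i> * bdot (f s (k - h)) (vec_of_int h)) *s g s h) \<le> real CARD('d) * (C * M h)"
        by (auto simp: eventually_at_filter)
      show "(\<lambda>h. real CARD('d) * (C * M h)) summable_on UNIV"
        by (intro summable_on_cmult_right M)
    qed
  qed
  show ?thesis
    unfolding smooth_curve_def
  proof (intro conjI ballI allI)
    show "rapid_on A (\<lambda>s. PP (f s) (g s))"
      by (rule rapid_on_le[OF rapid_on_conv[OF f(1) g(1)], where c = "1 + real CARD('d)"])
         (simp add: eq norm_leray_le)
    show "real_solenoidal (PP (f s) (g s))" if "s \<in> A" for s
      using f g that by (intro real_solenoidal_PP) (auto intro: rapid_onD)
    show "continuous_on A (\<lambda>s. PP (f s) (g s) k)" for k
    proof -
      have "continuous_on A (\<lambda>s. - leray (conv (f s) (g s)) k)"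
        unfolding leray_def divide_inverse
        by (intro continuous_intros cont bounded_bilinear.continuous_on[OF bounded_bilinear_smult]
            bounded_bilinear.continuous_on[OF bounded_bilinear_bdot])
      then show ?thesis by (simp add: eq cong: continuous_on_cong)
    qed
  qed
qed

lemma rapid_scaleR_sum:
  assumes "\<And>x. x \<in> I \<Longrightarrow> rapid (f x)"
  shows "rapid (\<lambda>k. \<Sum>x\<in>I. c x *\<^sub>R f x k)"
proof (rule rapid_on_sum)
  fix x assume "x \<in> I"
  then show "rapid (\<lambda>k. c x *\<^sub>R f x k)"
    by (intro rapid_on_le[OF assms, where c = "\<bar>c x\<bar>"]) auto
qed

lemma norm_coeff_le_Hnorm:
  fixes v :: "'d::finite coeffs"
  assumes v: "rapid v" and k: "k \<noteq> 0"
  shows "norm (v k) \<le> Hnorm 0 v"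
proof -
  let ?g = "\<lambda>k. wave_norm k powr (2 * 0) * (norm (v k))\<^sup>2"
  have "(norm (v k))\<^sup>2 = ?g k"
    using wave_norm_ge_1[OF k] by simp
  also have "?g k \<le> infsum ?g (- {0})"
    using finite_sum_le_infsum[OF rapid_Hspace_summable[OF v, of 0], of "{k}"] k by simp
  also have "\<dots> \<le> (2 * pi) ^ CARD('d) * infsum ?g (- {0})"
  proof -
    have "1 \<le> (2 * pi) ^ CARD('d)" using pi_ge_two by (intro one_le_power) simp
    moreover have "0 \<le> infsum ?g (- {0})" by (rule infsum_nonneg) auto
    ultimately show ?thesis using mult_right_mono[of 1 "(2 * pi) ^ CARD('d)"] by fastforce
  qed
  finally show ?thesis
    unfolding Hnorm_def by (rule real_le_rsqrt)
qed

text \<open>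
  A Fourier coefficient is a continuous functional on \<open>Hinf\<close>, so an integral in \<open>Hinf\<close> can only be
  the coefficientwise one.  This is the uniqueness half of the evaluation of \<open>Hinf_integral\<close>.
\<close>
lemma has_Hinf_integral_coeff:
  assumes "has_Hinf_integral f I a b"
  shows "((\<lambda>s. f s k) has_integral I k) {a..b}"
proof (cases "k = 0")
  case True
  have "f s 0 = 0" if "s \<in> {a..b}" for s
    using assms that by (auto simp: has_Hinf_integral_def Hinf_iff real_solenoidal_def)
  moreover have "I 0 = 0"
    using assms by (auto simp: has_Hinf_integral_def Hinf_iff real_solenoidal_def)
  ultimately show ?thesis using True has_integral_is_0 by metis
next
  case False
  let ?D = "\<lambda>p k. (\<Sum>(s, J)\<in>p. measure lborel J *\<^sub>R f s k) - I k"
  have lim: "((\<lambda>p. Hnorm 0 (?D p)) \<longlongrightarrow> 0) (division_filter (cbox a b))"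
    and f: "\<And>s. s \<in> {a..b} \<Longrightarrow> rapid (f s)" and I: "rapid I"
    using assms by (auto simp: has_Hinf_integral_def Hinf_iff)
  have "((\<lambda>p. ?D p k) \<longlongrightarrow> 0) (division_filter (cbox a b))"
  proof (rule Lim_null_comparison[OF _ lim])
    show "\<forall>\<^sub>F p in division_filter (cbox a b). norm (?D p k) \<le> Hnorm 0 (?D p)"
      using eventually_division_filter_tagged_division
    proof (rule eventually_mono)
      fix p assume p: "p tagged_division_of cbox a b"
      have "fst x \<in> {a..b}" if "x \<in> p" for x
        using tagged_division_ofD(2,3)[OF p, of "fst x" "snd x"] that by auto
      then have "rapid (\<lambda>k. \<Sum>x\<in>p. measure lborel (snd x) *\<^sub>R f (fst x) k)"
        by (intro rapid_scaleR_sum f)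
      moreover have "rapid (\<lambda>k. - I k)"
        by (rule rapid_on_le[OF I, where c = 1]) simp
      ultimately have "rapid (?D p)"
        using rapid_on_add by (force simp: case_prod_unfold)
      then show "norm (?D p k) \<le> Hnorm 0 (?D p)"
        using False by (rule norm_coeff_le_Hnorm)
    qed
  qed
  then have "((\<lambda>p. \<Sum>(s, J)\<in>p. measure lborel J *\<^sub>R f s k) \<longlongrightarrow> I k) (division_filter (cbox a b))"
    by (rule LIM_zero_cancel)
  then show ?thesis
    unfolding has_integral_cbox[symmetric] by simp
qed

lemma smooth_curve_integrable: "smooth_curve {a..b} f \<Longrightarrow> (\<lambda>s. f s k) integrable_on {a..b}"
  by (auto simp: smooth_curve_def intro: integrable_continuous_real)

text \<open>
  The integrand may depend on the upper limit \<open>t\<close>, as it does in Duhamel's formula.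
\<close>
lemma rapid_on_integral:
  fixes f :: "real \<Rightarrow> real \<Rightarrow> 'd::finite coeffs"
  assumes "\<And>n. \<exists>C. \<forall>t\<in>A. \<forall>s\<in>{a..t}. \<forall>k. weight k ^ n * norm (f t s k) \<le> C"
    and "\<And>t. t \<in> A \<Longrightarrow> a \<le> t \<and> t \<le> b"
    and "\<And>t k. t \<in> A \<Longrightarrow> (\<lambda>s. f t s k) integrable_on {a..t}"
  shows "rapid_on A (\<lambda>t k. integral {a..t} (\<lambda>s. f t s k))"
  unfolding rapid_on_def
proof
  fix n
  obtain C where C: "\<And>t s k. t \<in> A \<Longrightarrow> s \<in> {a..t} \<Longrightarrow> weight k ^ n * norm (f t s k) \<le> C"
    using assms(1)[of n] by metis
  have "weight k ^ n * norm (integral {a..t} (\<lambda>s. f t s k)) \<le> \<bar>C\<bar> * (b - a)" if t: "t \<in> A" for t k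
  proof -
    have "norm (f t s k) \<le> \<bar>C\<bar> / weight k ^ n" if "s \<in> {a..t}" for s
      using C[OF t that, of k] by (auto simp: field_simps)
    then have "norm (integral {a..t} (\<lambda>s. f t s k)) \<le> \<bar>C\<bar> / weight k ^ n * (t - a)"
      using has_integral_bound_real[OF _ _ integrable_integral[OF assms(3)[OF t, of k]],
          of "\<bar>C\<bar> / weight k ^ n" "{}"] assms(2)[OF t] by auto
    then have "weight k ^ n * norm (integral {a..t} (\<lambda>s. f t s k)) \<le> \<bar>C\<bar> * (t - a)"
      by (simp add: field_simps)
    also have "\<dots> \<le> \<bar>C\<bar> * (b - a)"
      using assms(2)[OF t] by (intro mult_left_mono) auto
    finally show ?thesis .
  qed
  then show "\<exists>C. \<forall>t\<in>A. \<forall>k. weight k ^ n * norm (integral {a..t} (\<lambda>s. f t s k)) \<le> C" by blast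
qed

lemma real_solenoidal_integral:
  assumes f: "smooth_curve {a..b} f"
  shows "real_solenoidal (\<lambda>k. integral {a..b} (\<lambda>s. f s k))"
proof -
  have rs: "\<And>s. s \<in> {a..b} \<Longrightarrow> real_solenoidal (f s)"
    using f by (auto simp: smooth_curve_def)
  note int = smooth_curve_integrable[OF f]
  have nth: "integral {a..b} (\<lambda>s. f s k) $ r = integral {a..b} (\<lambda>s. f s k $ r)" for k r
    using integral_linear[OF int[of k] bounded_linear_vec_nth[of r]] by (simp add: o_def)
  have "cnj (integral {a..b} (\<lambda>s. f s k) $ r) = integral {a..b} (\<lambda>s. f s (- k)) $ r" for k r
    unfolding nth integral_cnj by (rule integral_cong) (use rs in \<open>auto simp: real_solenoidal_def\<close>)
  moreover have "bdot (vec_of_int k) (integral {a..b} (\<lambda>s. f s k)) = 0" for k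
  proof -
    have "bdot (vec_of_int k) (integral {a..b} (\<lambda>s. f s k))
        = integral {a..b} (\<lambda>s. bdot (vec_of_int k) (f s k))"
      using integral_linear[OF int[of k] bounded_bilinear.bounded_linear_right[OF bounded_bilinear_bdot]]
      by (simp add: o_def)
    also have "\<dots> = integral {a..b} (\<lambda>s. 0)"
      by (rule integral_cong) (use rs in \<open>auto simp: real_solenoidal_def\<close>)
    finally show ?thesis by simp
  qed
  moreover have "integral {a..b} (\<lambda>s. f s 0) = integral {a..b} (\<lambda>s. 0)"
    by (rule integral_cong) (use rs in \<open>auto simp: real_solenoidal_def\<close>)
  ultimately show ?thesis by (simp add: real_solenoidal_def)
qed

text \<open>
  Riemann sums inherit the uniform decay of the curve, because the lengths of the intervals of a
  tagged division add up to the length of the whole interval.  So the Sobolev norms of the error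
  have a common summable majorant while each coefficient of the error tends to zero.
\<close>
lemma smooth_curve_has_Hinf_integral:
  fixes f :: "real \<Rightarrow> 'd::finite coeffs"
  assumes f: "smooth_curve {a..b} f" and ab: "a \<le> b"
  shows "has_Hinf_integral f (\<lambda>k. integral {a..b} (\<lambda>s. f s k)) a b"
proof -
  let ?I = "\<lambda>k. integral {a..b} (\<lambda>s. f s k)"
  let ?D = "\<lambda>p k. (\<Sum>(s, J)\<in>p. measure lborel J *\<^sub>R f s k) - ?I k"
  have rap: "rapid_on {a..b} f" using f by (simp add: smooth_curve_def)
  note int = smooth_curve_integrable[OF f]
  have "rapid_on {b} (\<lambda>t k. integral {a..t} (\<lambda>s. f s k))"
    using rap int ab by (intro rapid_on_integral[where b = b]) (auto simp: rapid_on_def)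
  then have I: "?I \<in> Hinf"
    using real_solenoidal_integral[OF f] rapid_onD by (force simp: Hinf_iff)
  have bound: "weight k ^ m * norm (?D p k) \<le> 2 * (b - a) * c"
    if p: "p tagged_division_of cbox a b"
      and c: "\<And>s. s \<in> {a..b} \<Longrightarrow> weight k ^ m * norm (f s k) \<le> c" for p k m c
  proof -
    have c': "\<forall>s\<in>cbox a b. norm (f s k) \<le> c / weight k ^ m"
      using c by (auto simp: field_simps)
    have "norm (\<Sum>(s, J)\<in>p. measure lborel J *\<^sub>R f s k) \<le> c / weight k ^ m * (b - a)"
      using rsum_bound[OF p c'] ab by simp
    moreover have "norm (?I k) \<le> c / weight k ^ m * (b - a)"
      using has_integral_bound_real[OF _ _ integrable_integral[OF int[of k]], of "c / weight k ^ m" "{}"]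
        c' ab order.trans[OF norm_ge_zero, of "f a k" "c / weight k ^ m"] by auto
    ultimately have "norm (?D p k) \<le> c / weight k ^ m * (b - a) + c / weight k ^ m * (b - a)"
      by (rule order.trans[OF norm_triangle_ineq4 add_mono])
    then show ?thesis by (simp add: field_simps)
  qed
  have "((\<lambda>p. Hnorm n (?D p)) \<longlongrightarrow> 0) (division_filter (cbox a b))" for n
  proof -
    obtain C where C: "C \<ge> 0" "\<And>s k. s \<in> {a..b} \<Longrightarrow> weight k ^ 0 * norm (f s k) \<le> C"
      by (rule rapid_onE[OF rap, where n = 0]) (rule that)
    obtain m :: nat where m: "2 * n \<le> real m"
      using real_arch_simple by blast
    obtain M where M: "M summable_on UNIV" "\<And>k. 0 \<le> M k"
      "\<And>s k. s \<in> {a..b} \<Longrightarrow> weight k ^ m * norm (f s k) \<le> M k"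
      by (rule rapid_on_dominated[OF rap, where n = m]) (rule that)
    have "((\<lambda>p. \<Sum>\<^sub>\<infinity>k\<in>- {0}. wave_norm k powr (2 * n) * (norm (?D p k))\<^sup>2) \<longlongrightarrow>
        (\<Sum>\<^sub>\<infinity>k\<in>- {0::int ^ 'd}. 0)) (division_filter (cbox a b))"
    proof (rule tendsto_infsum_dominated)
      fix k :: "int ^ 'd"
      have "((\<lambda>p. \<Sum>(s, J)\<in>p. measure lborel J *\<^sub>R f s k) \<longlongrightarrow> ?I k) (division_filter (cbox a b))"
        using integrable_integral[OF int[of k]] unfolding has_integral_cbox[symmetric] by simp
      then have "((\<lambda>p. ?D p k) \<longlongrightarrow> 0) (division_filter (cbox a b))"
        by (rule LIM_zero)
      then have "((\<lambda>p. wave_norm k powr (2 * n) * (norm (?D p k))\<^sup>2) \<longlongrightarrow>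
          wave_norm k powr (2 * n) * (norm (0::complex ^ 'd))\<^sup>2) (division_filter (cbox a b))"
        by (intro tendsto_intros)
      then show "((\<lambda>p. wave_norm k powr (2 * n) * (norm (?D p k))\<^sup>2) \<longlongrightarrow> 0) (division_filter (cbox a b))"
        by simp
    next
      let ?M = "\<lambda>k. (2 * (b - a) * M k) * (2 * (b - a) * C)"
      show "\<forall>\<^sub>F p in division_filter (cbox a b). \<forall>k\<in>- {0}.
          norm (wave_norm k powr (2 * n) * (norm (?D p k))\<^sup>2) \<le> ?M k"
        using eventually_division_filter_tagged_division
      proof (rule eventually_mono, intro ballI)
        fix p and k :: "int ^ 'd"
        assume p: "p tagged_division_of cbox a b" and k: "k \<in> - {0}"
        have "wave_norm k powr (2 * n) * (norm (?D p k))\<^sup>2 \<le> weight k ^ m * norm (?D p k) * norm (?D p k)"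
          using k by (intro Hspace_term_le m) auto
        also have "\<dots> \<le> ?M k"
          using bound[OF p M(3)] bound[OF p, of k 0 C] C M(2) ab
          by (intro mult_mono[of "weight k ^ m * norm (?D p k)"]) auto
        finally show "norm (wave_norm k powr (2 * n) * (norm (?D p k))\<^sup>2) \<le> ?M k"
          by simp
      qed
      have "M summable_on - {0}" using M(1) by (rule summable_on_subset) auto
      then show "?M summable_on - {0}"
        by (intro summable_on_cmult_left summable_on_cmult_right)
    qed
    then have "((\<lambda>p. sqrt ((2 * pi) ^ CARD('d) *
        (\<Sum>\<^sub>\<infinity>k\<in>- {0}. wave_norm k powr (2 * n) * (norm (?D p k))\<^sup>2))) \<longlongrightarrow>
        sqrt ((2 * pi) ^ CARD('d) * (\<Sum>\<^sub>\<infinity>k\<in>- {0::int ^ 'd}. 0))) (division_filter (cbox a b))"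
      by (intro tendsto_intros)
    then show ?thesis by (simp add: Hnorm_def)
  qed
  then show ?thesis
    unfolding has_Hinf_integral_def using I smooth_curve_Hinf[OF f] by blast
qed

lemma Hinf_integral_eq:
  assumes "smooth_curve {a..b} f" "a \<le> b"
  shows "Hinf_integral a b f = (\<lambda>k. integral {a..b} (\<lambda>s. f s k))"
  unfolding Hinf_integral_def
proof (rule the_equality)
  show "has_Hinf_integral f (\<lambda>k. integral {a..b} (\<lambda>s. f s k)) a b"
    using assms by (rule smooth_curve_has_Hinf_integral)
  show "I = (\<lambda>k. integral {a..b} (\<lambda>s. f s k))" if "has_Hinf_integral f I a b" for I
    by (rule ext, rule integral_unique[symmetric], rule has_Hinf_integral_coeff[OF that])
qed

text \<open>
  Continuity in \<open>t\<close> is not immediate because \<open>t\<close> occurs in the integrand as well as in the limit.  For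
  a single coefficient the semigroup is an exponential, so the dependence on \<open>t\<close> factors out of the
  integral.
\<close>
lemma smooth_curve_duhamel:
  assumes f: "smooth_curve {0..T} f"
  shows "smooth_curve {0..T} (\<lambda>t. Hinf_integral 0 t (\<lambda>s. heat (t - s) (f s)))"
proof -
  let ?I = "\<lambda>t k. integral {0..t} (\<lambda>s. heat (t - s) (f s) k)"
  have sub: "smooth_curve {0..t} (\<lambda>s. heat (t - s) (f s))" if "t \<in> {0..T}" for t
    using that by (intro smooth_curve_heat smooth_curve_subset[OF f]) auto
  have fT: "rapid_on {0..T} f"
    using f by (auto simp: smooth_curve_def)
  have "smooth_curve {0..T} ?I"
    unfolding smooth_curve_def
  proof (intro conjI ballI allI)
    show "rapid_on {0..T} ?I"
    proof (rule rapid_on_integral[where b = T])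
      fix n
      obtain C where C: "C \<ge> 0" "\<And>s k. s \<in> {0..T} \<Longrightarrow> weight k ^ n * norm (f s k) \<le> C"
        by (rule rapid_onE[OF fT, where n = n]) (rule that)
      have "weight k ^ n * norm (heat (t - s) (f s) k) \<le> C" if "t \<in> {0..T}" "s \<in> {0..t}" for t s k
        using C(2)[of s k] that norm_heat_le[of "t - s" "f s" k]
        by (intro order.trans[OF mult_left_mono[OF norm_heat_le] C(2)]) auto
      then show "\<exists>C. \<forall>t\<in>{0..T}. \<forall>s\<in>{0..t}. \<forall>k. weight k ^ n * norm (heat (t - s) (f s) k) \<le> C"
        by blast
    qed (use smooth_curve_integrable[OF sub] in auto)
    show "real_solenoidal (?I t)" if "t \<in> {0..T}" for t
      using sub[OF that] by (rule real_solenoidal_integral)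
    fix k
    let ?g = "\<lambda>s. exp (s * (wave_norm k)\<^sup>2) *\<^sub>R f s k"
    have "continuous_on {0..T} (\<lambda>s. f s k)"
      using f by (simp add: smooth_curve_def)
    then have "continuous_on {0..T} ?g"
      by (intro continuous_intros)
    then have "?g integrable_on {0..T}"
      by (rule integrable_continuous_real)
    then have cont: "continuous_on {0..T} (\<lambda>t. exp (- t * (wave_norm k)\<^sup>2) *\<^sub>R integral {0..t} ?g)"
      by (intro continuous_on_scaleR indefinite_integral_continuous_1 continuous_intros)
    have "?I t k = exp (- t * (wave_norm k)\<^sup>2) *\<^sub>R integral {0..t} ?g" for t
    proof -
      have "exp (- (t - s) * (wave_norm k)\<^sup>2) = exp (- t * (wave_norm k)\<^sup>2) * exp (s * (wave_norm k)\<^sup>2)" for s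
        by (simp add: exp_add[symmetric] algebra_simps)
      then show ?thesis by (simp add: heat_def integral_cmul[symmetric] del: integral_cmul)
    qed
    with cont show "continuous_on {0..T} (\<lambda>t. ?I t k)" by simp
  qed
  then show ?thesis
    by (subst smooth_curve_cong[where g = ?I]) (simp add: Hinf_integral_eq[OF sub])
qed

section \<open>The symmetry action on Fourier coefficients\<close>

text \<open>
  The symmetry formulas are stated with products by a transposed matrix on the left, which this
  rewrite rule would turn into products of a vector with a matrix on the right.
\<close>
declare transpose_matrix_vector [simp del]

lemma map_matrix_of_int_mult:
  "map_matrix of_int (A ** B) = map_matrix of_int A ** (map_matrix of_int B :: 'a::ring_1 ^ 'n ^ 'm)"
  by (simp add: vec_eq_iff matrix_matrix_mult_def)

lemma transpose_map_matrix: "transpose (map_matrix f A) = map_matrix f (transpose A)"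
  by (simp add: vec_eq_iff transpose_def)

text \<open>
  Over a field, a one-sided inverse of a square matrix is two-sided; to use this, the integer matrix
  is embedded into the real ones.
\<close>
lemma OZ_right_inverse:
  assumes "S \<in> OZ"
  shows "S ** transpose S = mat 1"
proof -
  let ?R = "map_matrix real_of_int"
  have one: "?R (mat 1) = mat 1" by (simp add: vec_eq_iff mat_def)
  have "?R (transpose S) ** ?R S = mat 1"
    using assms by (simp add: OZ_def map_matrix_of_int_mult[symmetric] one)
  then have "?R S ** ?R (transpose S) = mat 1"
    by (simp add: matrix_left_right_inverse)
  then have "?R (S ** transpose S) = ?R (mat 1)"
    by (simp add: map_matrix_of_int_mult one)
  then show ?thesis by (simp add: vec_eq_iff)
qed

lemma OZ_cancel:
  assumes "S \<in> OZ"
  shows "S *v (transpose S *v k) = k" "transpose S *v (S *v k) = k"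
  using OZ_right_inverse[OF assms] assms by (simp_all add: matrix_vector_mul_assoc OZ_def)

lemma bij_betw_transpose_OZ: "S \<in> OZ \<Longrightarrow> bij_betw ((*v) (transpose S)) UNIV UNIV"
  by (rule bij_betwI[of _ _ _ "(*v) S"]) (auto simp: OZ_cancel)

lemma wave_norm_OZ:
  assumes "S \<in> OZ"
  shows "wave_norm (transpose S *v k) = wave_norm k"
proof -
  have sq: "(wave_norm h)\<^sup>2 = real_of_int (bdot h h)" for h :: "int ^ 'a"
    by (simp add: bdot_def wave_norm_def norm_vec_def L2_set_def vec_of_int_def sum_nonneg
      power2_eq_square)
  have "bdot (transpose S *v k) (transpose S *v k) = bdot k k"
    by (simp add: bdot_matrix OZ_cancel(1)[OF assms])
  then have "(wave_norm (transpose S *v k))\<^sup>2 = (wave_norm k)\<^sup>2"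
    by (simp add: sq)
  then show ?thesis by simp
qed

lemma bounded_linear_matrix_vector: "bounded_linear (\<lambda>z. A *v z)"
  for A :: "complex ^ 'd ^ 'd"
  unfolding matrix_mult_sum
  by (intro bounded_linear_sum bounded_linear_compose[OF bounded_linear_smult_left]
      bounded_linear_vec_nth)

text \<open>
  The push-forward along \<open>x \<mapsto> S x + a\<close> on the level of coefficients; agreement with \<open>pushforward\<close> is
  shown in \<open>pushforward_eq\<close>.
\<close>
definition torus_action :: "int ^ 'd ^ 'd \<Rightarrow> real ^ 'd \<Rightarrow> 'd::finite coeffs \<Rightarrow> 'd coeffs" where
  "torus_action S a v k = fmode (- k) a *s (map_matrix of_int S *v v (transpose S *v k))"

lemma bounded_linear_torus_action:
  "bounded_linear (\<lambda>z. fmode (- k) a *s ((map_matrix of_int S :: complex ^ 'd ^ 'd) *v z))"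
  by (intro bounded_linear_compose[OF bounded_linear_smult_right] bounded_linear_matrix_vector)

lemma torus_action_scaleR: "torus_action S a (\<lambda>k. c *\<^sub>R v k) = (\<lambda>k. c *\<^sub>R torus_action S a v k)"
  unfolding torus_action_def
  by (rule ext, rule linear_scale[OF bounded_linear.linear[OF bounded_linear_torus_action]])

lemma torus_action_sum:
  "torus_action S a (\<lambda>k. \<Sum>i\<in>I. f i k) = (\<lambda>k. \<Sum>i\<in>I. torus_action S a (f i) k)"
  unfolding torus_action_def
  by (rule ext, rule linear_sum[OF bounded_linear.linear[OF bounded_linear_torus_action]])

lemma weight_OZ: "S \<in> OZ \<Longrightarrow> weight (transpose S *v k) = weight k"
  by (simp add: weight_def wave_norm_OZ)

lemma rapid_torus_action:
  fixes v :: "'d::finite coeffs"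
  assumes S: "S \<in> OZ" and v: "rapid v"
  shows "rapid (torus_action S a v)"
  unfolding rapid_on_def
proof
  fix n
  obtain C where C: "C \<ge> 0" "\<And>k. weight k ^ n * norm (v k) \<le> C"
    by (rule rapid_onE[OF v, where n = n]) auto
  obtain K where K: "K \<ge> 0" "\<And>z. norm ((map_matrix of_int S :: complex ^ 'd ^ 'd) *v z) \<le> norm z * K"
    using bounded_linear.nonneg_bounded[OF bounded_linear_matrix_vector] by blast
  have "weight k ^ n * norm (torus_action S a v k) \<le> C * K" for k
  proof -
    have "weight k ^ n * norm (torus_action S a v k) \<le> weight k ^ n * (norm (v (transpose S *v k)) * K)"
      unfolding torus_action_def norm_fmode_smult by (intro mult_left_mono K) auto
    also have "\<dots> \<le> C * K"
      using C(2)[of "transpose S *v k"] K(1)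
      by (simp add: weight_OZ[OF S] mult.assoc[symmetric] mult_right_mono)
    finally show ?thesis .
  qed
  then show "\<exists>C. \<forall>s\<in>UNIV. \<forall>k. weight k ^ n * norm (torus_action S a v k) \<le> C" by blast
qed

text \<open>
  Moving \<open>S\<close> across the phase shows that a mode composed with the inverse motion is, up to a constant
  phase, the mode with the rotated wave vector; the series is then reindexed by the bijection
  \<open>transpose S\<close>.
\<close>
lemma pushforward_eq:
  fixes v :: "'d::finite coeffs"
  assumes S: "S \<in> OZ" and v: "rapid v"
  shows "pushforward S a v = torus_action S a v"
proof -
  let ?C = "map_matrix of_int S :: complex ^ 'd ^ 'd"
  let ?R = "map_matrix of_int S :: real ^ 'd ^ 'd"
  have "?C *v synth v (transpose ?R *v (x - a)) = synth (torus_action S a v) x" for x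
  proof -
    let ?y = "transpose ?R *v (x - a)"
    have mode: "fmode (transpose S *v k) ?y = fmode k x * fmode (- k) a" for k
    proof -
      have "bdot (vec_of_int (transpose S *v k)) ?y = bdot (vec_of_int (S *v (transpose S *v k))) (x - a)"
        by (simp add: bdot_matrix vec_of_int_mult transpose_map_matrix)
      then have "fmode (transpose S *v k) ?y = fmode k (x - a)"
        by (simp add: fmode_def OZ_cancel(1)[OF S])
      also have "\<dots> = fmode k x * fmode (- k) a"
        by (simp add: fmode_def bdot_diff_right bdot_minus_left exp_add[symmetric] algebra_simps)
      finally show ?thesis .
    qed
    have "?C *v synth v ?y = (\<Sum>\<^sub>\<infinity>k. ?C *v (fmode k ?y *s v k))"
      unfolding synth_def
      by (rule infsum_linear[OF bounded_linear_matrix_vector summable_synth[OF rapid_norm_summable[OF v]], symmetric])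
    also have "\<dots> = (\<Sum>\<^sub>\<infinity>k. ?C *v (fmode (transpose S *v k) ?y *s v (transpose S *v k)))"
      by (rule infsum_reindex_bij_betw[OF bij_betw_transpose_OZ[OF S], symmetric])
    also have "\<dots> = synth (torus_action S a v) x"
      unfolding synth_def torus_action_def
      by (rule infsum_cong) (simp add: mode vector_scalar_commute[symmetric] vector_smult_assoc)
    finally show ?thesis .
  qed
  then have "pushforward S a v = fourier (synth (torus_action S a v))"
    by (simp add: pushforward_def)
  also have "\<dots> = torus_action S a v"
    by (rule fourier_synth[OF rapid_norm_summable[OF rapid_torus_action[OF S v]]])
  finally show ?thesis .
qed

lemma heat_torus_action:
  assumes "S \<in> OZ"
  shows "heat t (torus_action S a v) = torus_action S a (heat t v)"
proof
  fix k
  show "heat t (torus_action S a v) k = torus_action S a (heat t v) k"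
    using linear_scale[OF bounded_linear.linear[OF bounded_linear_torus_action[of k a S]], of
        "exp (- t * (wave_norm k)\<^sup>2)" "v (transpose S *v k)"]
    by (simp add: torus_action_def heat_def wave_norm_OZ[OF assms])
qed

lemma bdot_torus_action:
  assumes "S \<in> OZ"
  shows "bdot (vec_of_int h) (torus_action S a v k)
    = fmode (- k) a * bdot (vec_of_int (transpose S *v h)) (v (transpose S *v k))"
  by (simp add: torus_action_def bdot_smult_right bdot_matrix transpose_map_matrix vec_of_int_mult)

text \<open>
  The translation phases of the two factors multiply to the phase of the total wave vector, and the
  directional derivative is invariant because \<open>S\<close> is orthogonal.
\<close>
lemma conv_torus_action:
  fixes v w :: "'d::finite coeffs"
  assumes S: "S \<in> OZ" and v: "rapid v" and w: "rapid w"
  shows "conv (torus_action S a v) (torus_action S a w) = torus_action S a (conv v w)"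
proof
  fix k
  let ?L = "\<lambda>z. fmode (- k) a *s ((map_matrix of_int S :: complex ^ 'd ^ 'd) *v z)"
  let ?t = "\<lambda>h. (\<i> * bdot (v (transpose S *v k - h)) (vec_of_int h)) *s w h"
  have "torus_action S a (conv v w) k = (\<Sum>\<^sub>\<infinity>h. ?L (?t h))"
    unfolding torus_action_def conv_def
    by (rule infsum_linear[OF bounded_linear_torus_action conv_summable[OF v w], symmetric])
  also have "\<dots> = (\<Sum>\<^sub>\<infinity>h. ?L (?t (transpose S *v h)))"
    by (rule infsum_reindex_bij_betw[OF bij_betw_transpose_OZ[OF S], symmetric])
  also have "\<dots> = conv (torus_action S a v) (torus_action S a w) k"
    unfolding conv_def
  proof (rule infsum_cong)
    fix h
    have phase: "fmode (- k) a = fmode (- (k - h)) a * fmode (- h) a"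
      by (simp add: fmode_add_left[symmetric])
    have "bdot (torus_action S a v (k - h)) (vec_of_int h) = fmode (- (k - h)) a *
        bdot (v (transpose S *v k - transpose S *v h)) (vec_of_int (transpose S *v h))"
      using bdot_torus_action[OF S, of h a v "k - h"]
      by (simp add: bdot_commute matrix_vector_mult_diff_distrib)
    then show "?L (?t (transpose S *v h)) =
        (\<i> * bdot (torus_action S a v (k - h)) (vec_of_int h)) *s torus_action S a w h"
      unfolding phase by (simp add: torus_action_def vector_scalar_commute[symmetric] vector_smult_assoc mult_ac)
  qed
  finally show "conv (torus_action S a v) (torus_action S a w) k = torus_action S a (conv v w) k" ..
qed

lemma leray_torus_action:
  fixes v :: "'d::finite coeffs"
  assumes S: "S \<in> OZ"
  shows "leray (torus_action S a v) = torus_action S a (leray v)"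
proof
  fix k
  let ?C = "map_matrix of_int S :: complex ^ 'd ^ 'd"
  let ?L = "\<lambda>z. fmode (- k) a *s (?C *v z)"
  let ?k = "transpose S *v k"
  let ?b = "bdot (vec_of_int ?k) (v ?k)"
  let ?W = "of_real ((wave_norm k)\<^sup>2) :: complex"
  have k: "?C *v vec_of_int ?k = vec_of_int k"
    by (simp add: vec_of_int_mult[symmetric] OZ_cancel(1)[OF S])
  have "torus_action S a (leray v) k = ?L (v ?k - (?b / ?W) *s vec_of_int ?k)"
    by (simp add: torus_action_def leray_def wave_norm_OZ[OF S])
  also have "\<dots> = ?L (v ?k) - ?L ((?b / ?W) *s vec_of_int ?k)"
    by (rule linear_diff[OF bounded_linear.linear[OF bounded_linear_torus_action]])
  also have "?L ((?b / ?W) *s vec_of_int ?k) = (fmode (- k) a * ?b / ?W) *s vec_of_int k"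
    by (simp only: vector_scalar_commute k vector_smult_assoc times_divide_eq_right)
  also have "?L (v ?k) - (fmode (- k) a * ?b / ?W) *s vec_of_int k = leray (torus_action S a v) k"
    unfolding leray_def bdot_torus_action[OF S] by (simp only: torus_action_def)
  finally show "leray (torus_action S a v) k = torus_action S a (leray v) k" ..
qed

lemma PP_torus_action:
  assumes S: "S \<in> OZ" and v: "rapid v" and w: "rapid w"
  shows "PP (torus_action S a v) (torus_action S a w) = torus_action S a (PP v w)"
proof -
  have "torus_action S a (\<lambda>k. - leray (conv v w) k) = (\<lambda>k. - torus_action S a (leray (conv v w)) k)"
    using torus_action_scaleR[of S a "-1" "leray (conv v w)"] by simp
  then show ?thesis
    by (simp add: PP_eq rapid_torus_action conv_torus_action leray_torus_action assms)
qed

lemma PP_scaleR: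
  fixes v w :: "'d::finite coeffs"
  assumes v: "rapid v" and w: "rapid w"
  shows "PP (\<lambda>k. b *\<^sub>R v k) (\<lambda>k. c *\<^sub>R w k) = (\<lambda>k. (b * c) *\<^sub>R PP v w k)"
proof
  fix k
  have rap: "rapid (\<lambda>k. x *\<^sub>R z k)" if "rapid z" for x and z :: "'d coeffs"
    by (rule rapid_on_le[OF that, where c = "\<bar>x\<bar>"]) simp
  have "conv (\<lambda>k. b *\<^sub>R v k) (\<lambda>k. c *\<^sub>R w k) k = (b * c) *\<^sub>R conv v w k" for k
    unfolding conv_def infsum_scaleR_right[symmetric]
    by (rule infsum_cong) (simp add: bdot_smult_left scaleR_eq_smult vector_smult_assoc)
  then have "leray (conv (\<lambda>k. b *\<^sub>R v k) (\<lambda>k. c *\<^sub>R w k)) k = (b * c) *\<^sub>R leray (conv v w) k"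
    by (simp add: leray_def bdot_scaleR_right scaleR_right_diff_distrib)
       (simp add: scaleR_eq_smult vector_smult_assoc scaleR_conv_of_real)
  then show "PP (\<lambda>k. b *\<^sub>R v k) (\<lambda>k. c *\<^sub>R w k) k = (b * c) *\<^sub>R PP v w k"
    by (simp add: PP_eq rap v w)
qed

lemma heat_scaleR: "heat t (\<lambda>k. c *\<^sub>R v k) = (\<lambda>k. c *\<^sub>R heat t v k)"
  by (simp add: heat_def mult.commute)

lemma torus_action_integral:
  fixes f :: "real \<Rightarrow> 'd::finite coeffs"
  assumes f: "smooth_curve {0..t} f" and t: "0 \<le> t"
    and act: "\<And>s. s \<in> {0..t} \<Longrightarrow> torus_action S a (f s) = (\<lambda>k. c *\<^sub>R f s k)"
  shows "torus_action S a (Hinf_integral 0 t f) = (\<lambda>k. c *\<^sub>R Hinf_integral 0 t f k)"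
proof
  fix k
  have "torus_action S a (Hinf_integral 0 t f) k = integral {0..t} (\<lambda>s. torus_action S a (f s) k)"
    unfolding Hinf_integral_eq[OF f t] torus_action_def
    using integral_linear[OF smooth_curve_integrable[OF f, of "transpose S *v k"]
        bounded_linear_torus_action[of k a S]]
    by (simp add: o_def)
  also have "\<dots> = integral {0..t} (\<lambda>s. c *\<^sub>R f s k)"
    by (rule integral_cong) (simp add: act)
  finally show "torus_action S a (Hinf_integral 0 t f) k = c *\<^sub>R Hinf_integral 0 t f k"
    by (simp add: Hinf_integral_eq[OF f t])
qed

section \<open>Propagation of the symmetry through the recursion\<close>

theorem mainTheorem3:
  fixes u_star :: "'d::finite coeffs"
    and N :: nat
    and u :: "nat \<Rightarrow> real \<Rightarrow> 'd coeffs"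
    and \<sigma> :: real
  assumes dim: "CARD('d) \<ge> 2"
    and u_star: "u_star \<in> Hinf"
    and u_0: "\<And>t. t \<ge> 0 \<Longrightarrow> u 0 t = heat t u_star"
    and u_j: "\<And>j t. j \<in> {1..N} \<Longrightarrow> t \<ge> 0 \<Longrightarrow>
      u j t = (\<lambda>k. \<Sum>l = 0..j - 1.
        Hinf_integral 0 t (\<lambda>s. heat (t - s) (PP (u l s) (u (j - l - 1) s))) k)"
    and sigma: "\<sigma> \<in> {1, -1}"
  shows "\<forall>(S, a) \<in> sym_set \<sigma> u_star. \<forall>j \<in> {0..N}. \<forall>t \<ge> 0.
      pushforward S a (u j t) = (\<lambda>k. \<sigma> ^ (j + 1) *\<^sub>R u j t k) \<and>
      (\<forall>k. u j t (S *v k) = \<sigma> ^ (j + 1) *\<^sub>R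
        (exp (- \<i> * of_real (bdot a (vec_of_int (S *v k)))) *s (map_matrix of_int S *v u j t k)))"
proof -
  have smooth: "smooth_curve {0..T} (u j)" if "j \<le> N" for j T
    using that
  proof (induction j rule: less_induct)
    case (less j)
    show ?case
    proof (cases "j = 0")
      case True
      then show ?thesis
        using smooth_curve_heat_orbit[OF u_star, of T] u_0
        by (subst smooth_curve_cong[where g = "\<lambda>t. heat t u_star"]) auto
    next
      case False
      then have "smooth_curve {0..T} (\<lambda>t k. \<Sum>l = 0..j - 1.
          Hinf_integral 0 t (\<lambda>s. heat (t - s) (PP (u l s) (u (j - l - 1) s))) k)"
        using less.prems
        by (intro smooth_curve_sum smooth_curve_duhamel smooth_curve_PP less.IH) auto
      then show ?thesis
        using u_j[of j] False less.prems by (subst smooth_curve_cong) auto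
    qed
  qed
  have rap: "rapid (u j t)" if "j \<le> N" "t \<ge> 0" for j t
    using smooth_curve_Hinf[OF smooth[OF that(1), of t], of t] that(2) by (auto simp: Hinf_iff)
  have sym: "torus_action S a (u j t) = (\<lambda>k. \<sigma> ^ (j + 1) *\<^sub>R u j t k)"
    if Sa: "(S, a) \<in> sym_set \<sigma> u_star" and "j \<le> N" "t \<ge> 0" for S a j t
    using that(2,3)
  proof (induction j arbitrary: t rule: less_induct)
    case (less j)
    have S: "S \<in> OZ" using Sa by (simp add: sym_set_def)
    show ?case
    proof (cases "j = 0")
      case True
      have "torus_action S a u_star = (\<lambda>k. \<sigma> *\<^sub>R u_star k)"
        using Sa u_star by (auto simp: sym_set_def Hinf_iff pushforward_eq)
      then show ?thesis
        using True less.prems by (simp add: u_0 heat_torus_action[OF S, symmetric] heat_scaleR)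
    next
      case False
      let ?f = "\<lambda>l s. heat (t - s) (PP (u l s) (u (j - l - 1) s))"
      have summand: "torus_action S a (Hinf_integral 0 t (?f l))
          = (\<lambda>k. \<sigma> ^ (j + 1) *\<^sub>R Hinf_integral 0 t (?f l) k)" if l: "l \<in> {0..j - 1}" for l
      proof (rule torus_action_integral)
        have lj: "l < j" "j - l - 1 < j" "l \<le> N" "j - l - 1 \<le> N"
          using l False less.prems by auto
        show "smooth_curve {0..t} (?f l)"
          by (intro smooth_curve_heat smooth_curve_PP smooth lj)
        fix s assume s: "s \<in> {0..t}"
        have "torus_action S a (?f l s)
            = heat (t - s) (PP (torus_action S a (u l s)) (torus_action S a (u (j - l - 1) s)))"
          using lj s by (simp add: heat_torus_action[OF S] PP_torus_action[OF S] rap)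
        also have "\<dots> = (\<lambda>k. (\<sigma> ^ (l + 1) * \<sigma> ^ (j - l - 1 + 1)) *\<^sub>R ?f l s k)"
          using lj s by (simp add: less.IH PP_scaleR rap heat_scaleR)
        also have "\<sigma> ^ (l + 1) * \<sigma> ^ (j - l - 1 + 1) = \<sigma> ^ (j + 1)"
        proof -
          have "l + 1 + (j - l - 1 + 1) = j + 1" using lj by arith
          then show ?thesis by (simp only: power_add[symmetric])
        qed
        finally show "torus_action S a (?f l s) = (\<lambda>k. \<sigma> ^ (j + 1) *\<^sub>R ?f l s k)" .
      qed (use less.prems in simp)
      have uj: "u j t = (\<lambda>k. \<Sum>l = 0..j - 1. Hinf_integral 0 t (?f l) k)"
        using u_j[of j t] False less.prems by auto
      show ?thesis
        unfolding uj torus_action_sum scaleR_sum_right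
        by (rule ext, rule sum.cong[OF refl]) (simp only: summand)
    qed
  qed
  show ?thesis
  proof (clarify, intro conjI allI)
    fix S a j t k
    assume Sa: "(S, a) \<in> sym_set \<sigma> u_star" and j: "j \<in> {0..N}" and t: "0 \<le> (t::real)"
    have S: "S \<in> OZ" using Sa by (simp add: sym_set_def)
    have act: "torus_action S a (u j t) = (\<lambda>k. \<sigma> ^ (j + 1) *\<^sub>R u j t k)"
      using sym[OF Sa _ t, of j] j by simp
    show "pushforward S a (u j t) = (\<lambda>k. \<sigma> ^ (j + 1) *\<^sub>R u j t k)"
      using j t by (simp add: pushforward_eq[OF S rap] act)
    have "\<sigma> ^ (j + 1) * \<sigma> ^ (j + 1) = 1"
      using sigma by (auto simp: power_mult_distrib[symmetric])
    then have "u j t (S *v k) = \<sigma> ^ (j + 1) *\<^sub>R torus_action S a (u j t) (S *v k)"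
      by (simp add: act)
    also have "torus_action S a (u j t) (S *v k) = exp (- \<i> * of_real (bdot a (vec_of_int (S *v k))))
        *s (map_matrix of_int S *v u j t k)"
      by (simp add: torus_action_def OZ_cancel(2)[OF S] fmode_def bdot_minus_left bdot_commute[of a])
    finally show "u j t (S *v k) = \<sigma> ^ (j + 1) *\<^sub>R
        (exp (- \<i> * of_real (bdot a (vec_of_int (S *v k)))) *s (map_matrix of_int S *v u j t k))" .
  qed
qed

end
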